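(* Let $1\leq k<\ell$ be integers and let $G$ be a compact abelian group of the form $G=\mathbb{I}\times M$, where $\mathbb{I}$ is the identity component of $G$. Then $$\lambda_{k,\ell}(G)=\max\{\lambda_{k,\ell}(M),\lambda_{k,\ell}(\mathbb{I})\}.$$ Moreover, if $\mathbb{I}$ is nontrivial, then $\lambda_{k,\ell}(\mathbb{I})=\frac{1}{k+\ell}$ and $$\lambda_{k,\ell}(G)=\max\left\{\lambda_{k,\ell}(M),\frac{1}{k+\ell}\right\}.$$
   Context: For a subset $A$ of an abelian group and a positive integer $k$, $kA=A+\cdots+A$ ($k$ summands) denotes the $k$-fold Minkowski sum $\{a_1+\cdots+a_k: a_i\in A\}$ (not the dilation). A set $A$ is $(k,\ell)$-sum-free if $kA\cap\ell A=\emptyset$. For a compact abelian group $G$ with Haar probability measure $\mu$ (normalized so $\mu(G)=1$), $\lambda_{k,\ell}(G)=\sup\{\mu(A): A\subseteq G \text{ measurable},\ kA\cap\ell A=\emptyset\}$. The groups $\mathbb{I}$ and $M$ (each compact abelian, as factors of $G$) carry their own Haar probability measures. *)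

theory Defs
  imports "HOL-Analysis.Analysis" "HOL-Probability.Probability_Measure"
begin

instance prod :: (topological_monoid_add, topological_monoid_add) topological_monoid_add
proof
  fix a b :: "'a \<times> 'b"
  have a: "((\<lambda>x. fst x) \<longlongrightarrow> a) (nhds a \<times>\<^sub>F nhds b)" "((\<lambda>x. snd x) \<longlongrightarrow> b) (nhds a \<times>\<^sub>F nhds b)"
    by (rule filterlim_fst filterlim_snd)+
  show "LIM x (nhds a \<times>\<^sub>F nhds b). fst x + snd x :> nhds (a + b)"
    unfolding plus_prod_def by (intro tendsto_Pair tendsto_add tendsto_fst tendsto_snd a)
qed

instance prod :: (topological_group_add, topological_group_add) topological_group_add
proof
  fix a :: "'a \<times> 'b"
  have a: "((\<lambda>x. x) \<longlongrightarrow> a) (nhds a)"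
    by (rule filterlim_ident)
  show "(uminus \<longlongrightarrow> - a) (nhds a)"
    unfolding uminus_prod_def by (intro tendsto_Pair tendsto_minus tendsto_fst tendsto_snd a)
qed

instance prod :: (topological_ab_group_add, topological_ab_group_add) topological_ab_group_add ..

definition sumset_pow :: "nat \<Rightarrow> 'a::comm_monoid_add set \<Rightarrow> 'a set" where
  "sumset_pow k A = {(\<Sum>i<k. a i) | a. \<forall>i<k. a i \<in> A}"

definition sum_free :: "nat \<Rightarrow> nat \<Rightarrow> 'a::comm_monoid_add set \<Rightarrow> bool" where
  "sum_free k l A \<longleftrightarrow> sumset_pow k A \<inter> sumset_pow l A = {}"

text \<open>Haar measure as a Radon measure on the Borel sets. The two regularity conditions are
  automatic for second countable compact groups but not in general, and they are part of what
  makes Haar measure unique.\<close>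

definition haar_prob :: "'a::{topological_ab_group_add, t2_space} measure \<Rightarrow> bool" where
  "haar_prob \<mu> \<longleftrightarrow>
     prob_space \<mu> \<and> sets \<mu> = sets borel \<and>
     (\<forall>g. \<forall>A\<in>sets borel. emeasure \<mu> ((\<lambda>x. g + x) ` A) = emeasure \<mu> A) \<and>
     (\<forall>A\<in>sets borel. emeasure \<mu> A = (INF U\<in>{U. open U \<and> A \<subseteq> U}. emeasure \<mu> U)) \<and>
     (\<forall>U. open U \<longrightarrow> emeasure \<mu> U = (SUP K\<in>{K. compact K \<and> K \<subseteq> U}. emeasure \<mu> K))"

text \<open>The parameter \<open>\<mu>\<close> is meant to be the Haar probability measure of a compact group; the
  supremum is then over a nonempty set of reals (the empty set is sum-free if \<open>k\<close> or \<open>l\<close> is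
  positive) bounded by 1.\<close>

definition lambda_kl ::
    "nat \<Rightarrow> nat \<Rightarrow> 'a::{topological_ab_group_add, t2_space} measure \<Rightarrow> real" where
  "lambda_kl k l \<mu> = Sup {measure \<mu> A | A. A \<in> sets \<mu> \<and> sum_free k l A}"

end

theory Submission
  imports Defs
begin

text \<open>Upper bound. If \<open>c \<in> A + B\<close> then \<open>\<mu>(A + B) \<ge> \<mu>(A) + \<mu>(B) - \<mu>(A \<inter> (c - B))\<close>, by iterating Dyson
  transforms. Hence, if \<open>\<mu>(A + B) < \<mu>(A) + \<mu>(B)\<close> for compact \<open>A\<close> and \<open>B\<close>, then \<open>A \<inter> (c - B)\<close> has positive
  measure for all \<open>c \<in> A + B\<close>, and so \<open>A + B\<close> contains a neighbourhood of each of its points. For a compact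
  sum-free \<open>K \<subseteq> G\<close> with \<open>(k + l) \<mu>(K) > 1\<close> the set \<open>lK - kK\<close> is therefore open and closed; it misses \<open>0\<close>,
  hence the whole identity component, and the projection of \<open>K\<close> to \<open>M\<close> is sum-free as well.

  Lower bound. A nontrivial connected compact abelian group has a nontrivial continuous character,
  which maps onto the circle; pull back a suitable arc of length \<open>1/(k + l)\<close>. The character is found
  without representation theory: power iteration of a convolution operator yields a continuous
  idempotent, and a minimal idempotent is an eigenfunction of all translations.\<close>

section \<open>Translation-invariant measures on compact groups\<close>

text \<open>Without second countability, Borel sets of a product may fall outside the product
  sigma-algebra, so Fubini does not apply to addition directly; one variable is first rounded to
  finitely many values. Moreover \<open>\<mu>G\<close> is not given as a product measure: it is
  linked to the measures on the factors by uniqueness of Haar measure, applied to the coordinate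
  projections.

  The constant \<open>1 / (k + l)\<close> arises as follows. If \<open>lK - kK\<close> is not open,
  then neither are \<open>kK\<close>, \<open>lK\<close> and their partial sums, so measures are
  superadditive at every step, and \<open>(k + l) \<mu>(K)\<close> is at most the total mass 1.

  Minimal idempotents exist because the squared norm of an idempotent is the dimension of its range:
  it is additive when an idempotent splits and at least 1 for each piece, so splitting must
  stop.\<close>

lemma continuous_on_plus_pair:
  "continuous_on UNIV (\<lambda>p::'a::topological_monoid_add \<times> 'a. fst p + snd p)"
  by (intro continuous_intros)

lemma compact_plus_nhd_subset:
  fixes K U :: "'a::topological_monoid_add set"
  assumes "compact K" "open U" "K \<subseteq> U"
  obtains V where "open V" "0 \<in> V" "\<And>x v. x \<in> K \<Longrightarrow> v \<in> V \<Longrightarrow> x + v \<in> U"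
proof -
  have op: "open ((\<lambda>p::'a \<times> 'a. fst p + snd p) -` U)"
    using continuous_on_plus_pair assms(2) by (rule open_vimage[rotated])
  have "\<forall>x\<in>K. \<exists>A B. open A \<and> open B \<and> x \<in> A \<and> 0 \<in> B \<and> (\<forall>y\<in>A. \<forall>v\<in>B. y + v \<in> U)"
  proof
    fix x assume "x \<in> K"
    then have "(x, 0) \<in> (\<lambda>p::'a \<times> 'a. fst p + snd p) -` U" using assms(3) by auto
    then obtain A B where
      "open A" "open B" "(x,0) \<in> A \<times> B" "A \<times> B \<subseteq> (\<lambda>p. fst p + snd p) -` U"
      by (rule open_prod_elim[OF op])
    then show "\<exists>A B. open A \<and> open B \<and> x \<in> A \<and> 0 \<in> B \<and> (\<forall>y\<in>A. \<forall>v\<in>B. y + v \<in> U)"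
      by (intro exI[of _ A] exI[of _ B]) auto
  qed
  from bchoice[OF this] obtain A where
    "\<forall>x\<in>K. \<exists>B. open (A x) \<and> open B \<and> x \<in> A x \<and> 0 \<in> B \<and> (\<forall>y\<in>A x. \<forall>v\<in>B. y + v \<in> U)" ..
  from bchoice[OF this] obtain B where
    AB: "\<forall>x\<in>K. open (A x) \<and> open (B x) \<and> x \<in> A x \<and> 0 \<in> B x \<and> (\<forall>y\<in>A x. \<forall>v\<in>B x. y + v \<in> U)" ..
  have "K \<subseteq> (\<Union>x\<in>K. A x)" using AB by auto
  then obtain C where C: "C \<subseteq> K" "finite C" "K \<subseteq> (\<Union>x\<in>C. A x)"
    by (rule compactE_image[OF assms(1), rotated]) (use AB in auto)
  show thesis
  proof
    show "open (\<Inter>x\<in>C. B x)" using C AB by (intro open_INT) auto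
    show "0 \<in> (\<Inter>x\<in>C. B x)" using C AB by auto
    fix x v assume "x \<in> K" "v \<in> (\<Inter>x\<in>C. B x)"
    then show "x + v \<in> U" using C AB by blast
  qed
qed

lemma open_plus_image:
  fixes U :: "'a::topological_ab_group_add set"
  assumes "open U" shows "open ((\<lambda>x. c + x) ` U)"
proof -
  have "(\<lambda>x. c + x) ` U = (\<lambda>x. - c + x) -` U" by (force simp: image_iff)
  then show ?thesis using assms by (auto intro!: open_vimage continuous_intros)
qed

lemma plus_image_eq_vimage:
  fixes A :: "'a::ab_group_add set" shows "(\<lambda>x. c + x) ` A = (\<lambda>x. - c + x) -` A"
  by (force simp: image_iff)

lemma uminus_image_eq_vimage:
  fixes A :: "'a::ab_group_add set" shows "uminus ` A = uminus -` A"
  by (force simp: image_iff)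

lemma borel_measurable_plus_const [measurable]:
  "(\<lambda>x. c + x :: 'a::topological_ab_group_add) \<in> borel_measurable borel"
  by (intro borel_measurable_continuous_onI continuous_intros)

lemma borel_measurable_uminus_group [measurable]:
  "(uminus :: 'a::topological_ab_group_add \<Rightarrow> 'a) \<in> borel_measurable borel"
  by (intro borel_measurable_continuous_onI continuous_intros)

lemma borel_plus_image:
  fixes A :: "'a::topological_ab_group_add set"
  assumes "A \<in> sets borel" shows "(\<lambda>x. c + x) ` A \<in> sets borel"
  using measurable_sets[OF borel_measurable_plus_const[of "-c"] assms] plus_image_eq_vimage[of c A]
  by simp

lemma borel_uminus_image:
  fixes A :: "'a::topological_ab_group_add set"
  assumes "A \<in> sets borel" shows "uminus ` A \<in> sets borel"
  using measurable_sets[OF borel_measurable_uminus_group assms] uminus_image_eq_vimage[of A] by simp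

text \<open>Finitely many translates of \<open>V\<close> cover the group, and \<open>p\<close> picks
  the base point of one of them. What depends on \<open>x\<close> only through \<open>p x\<close>
  splits into finitely many rectangles and is measurable for the product sigma-algebra. The finite
  range also serves as a pigeonhole principle.\<close>

lemma simple_rounding:
  fixes V :: "'a::topological_ab_group_add set"
  assumes "compact (UNIV :: 'a set)" "open V" "0 \<in> V"
  obtains p where "simple_function borel p" "\<And>x. x - p x \<in> V"
proof -
  have "UNIV \<subseteq> (\<Union>c\<in>UNIV. (\<lambda>x. c + x) ` V)" using assms(3) by force
  then obtain C where C: "finite C" "UNIV \<subseteq> (\<Union>c\<in>C. (\<lambda>x. c + x) ` V)"
    by (rule compactE_image[OF assms(1), rotated]) (use open_plus_image[OF assms(2)] in auto)
  have "\<exists>p. simple_function borel p \<and> (\<forall>x \<in> (\<Union>c\<in>C. (\<lambda>x. c + x) ` V). x - p x \<in> V)"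
    using C(1)
  proof (induction C)
    case empty
    show ?case by (intro exI[of _ "\<lambda>_. 0"]) auto
  next
    case (insert c C)
    from insert.IH obtain p
      where p: "simple_function borel p" "\<forall>x \<in> (\<Union>c\<in>C. (\<lambda>x. c + x) ` V). x - p x \<in> V"
      by (elim exE conjE)
    have "simple_function borel (\<lambda>x. if x \<in> (\<lambda>x. c + x) ` V then c else p x)"
      using p(1) open_plus_image[OF assms(2), of c]
      by (intro simple_function_If_set) auto
    then show ?case using p(2)
      by (intro exI[of _ "\<lambda>x. if x \<in> (\<lambda>x. c + x) ` V then c else p x"]) auto
  qed
  then obtain p where p: "simple_function borel p" "\<forall>x \<in> (\<Union>c\<in>C. (\<lambda>x. c + x) ` V). x - p x \<in> V"
    by (elim exE conjE)
  have "x - p x \<in> V" for x using p(2) C(2) by (meson UNIV_I subsetD)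
  then show thesis using p(1) by (rule that[rotated])
qed

text \<open>\<open>haar_prob\<close> without regularity: the image of a Haar measure under a
  homomorphism is visibly invariant, while its regularity is not known in advance.\<close>

definition translation_invariant :: "'a::topological_ab_group_add measure \<Rightarrow> bool" where
  "translation_invariant \<mu> \<longleftrightarrow> prob_space \<mu> \<and> sets \<mu> = sets borel \<and>
     (\<forall>g. \<forall>A\<in>sets borel. emeasure \<mu> ((\<lambda>x. g + x) ` A) = emeasure \<mu> A)"

lemma haar_imp_translation_invariant: "haar_prob \<mu> \<Longrightarrow> translation_invariant \<mu>"
  by (simp add: haar_prob_def translation_invariant_def)

text \<open>Both sides are compared with the \<open>\<mu> \<otimes> \<nu>\<close>-measure of \<open>{(x, y). x + y \<in> K}\<close>. This set need not
  belong to the product \<open>\<sigma>\<close>-algebra, so \<open>x\<close> is first rounded to finitely many values.\<close>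

lemma translation_invariant_le:
  fixes \<mu> \<nu> :: "'a::{topological_ab_group_add, t2_space} measure"
  assumes c: "compact (UNIV :: 'a set)"
    and \<mu>: "translation_invariant \<mu>" and \<nu>: "translation_invariant \<nu>"
    and K: "compact K" and U: "open U" and KU: "K \<subseteq> U"
  shows "emeasure \<nu> K \<le> emeasure \<mu> U"
proof -
  interpret M: prob_space \<mu> using \<mu> by (simp add: translation_invariant_def)
  interpret N: prob_space \<nu> using \<nu> by (simp add: translation_invariant_def)
  interpret P: pair_prob_space \<mu> \<nu> ..
  have sM [measurable_cong]: "sets \<mu> = sets borel" and sN [measurable_cong]: "sets \<nu> = sets borel"
    using \<mu> \<nu> by (auto simp: translation_invariant_def)
  obtain V where V: "open V" "0 \<in> V" "\<And>x v. x \<in> K \<Longrightarrow> v \<in> V \<Longrightarrow> x + v \<in> U"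
    using compact_plus_nhd_subset[OF K U KU] by blast
  obtain p where p: "simple_function borel p" "\<And>x::'a. x - p x \<in> V"
    using simple_rounding[OF c V(1,2)] by blast
  have Kb: "K \<in> sets borel" and Ub: "U \<in> sets borel"
    using K U by (auto simp: borel_compact)
  have pv: "p -` {x} \<in> sets borel" for x
    using simple_functionD(2)[OF p(1), of "{x}"] by simp
  have fin: "finite (range p)" using simple_functionD(1)[OF p(1)] by simp
  define E where "E = (\<Union>z\<in>range p. (p -` {z}) \<times> ((\<lambda>x. - z + x) ` K))"
  have E: "E \<in> sets (\<mu> \<Otimes>\<^sub>M \<nu>)"
    using fin pv borel_plus_image[OF Kb] unfolding sM sN E_def
    by (intro sets.finite_UN pair_measureI) (simp_all only: sM sN)
  have in_E: "(x, y) \<in> E \<longleftrightarrow> p x + y \<in> K" for x y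
    unfolding E_def plus_image_eq_vimage by auto
  have "emeasure (\<mu> \<Otimes>\<^sub>M \<nu>) E = (\<integral>\<^sup>+ x. emeasure \<nu> (Pair x -` E) \<partial>\<mu>)"
    using E by (rule N.emeasure_pair_measure_alt)
  also have "\<dots> = (\<integral>\<^sup>+ x. emeasure \<nu> K \<partial>\<mu>)"
  proof (rule nn_integral_cong)
    fix x
    have "Pair x -` E = (\<lambda>y. - p x + y) ` K"
      unfolding plus_image_eq_vimage by (simp add: in_E set_eq_iff)
    then show "emeasure \<nu> (Pair x -` E) = emeasure \<nu> K"
      using \<nu> Kb unfolding translation_invariant_def by metis
  qed
  also have "\<dots> = emeasure \<nu> K" by (simp add: M.emeasure_space_1)
  finally have 1: "emeasure (\<mu> \<Otimes>\<^sub>M \<nu>) E = emeasure \<nu> K" .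
  \<comment> \<open>In the other order, the section at \<open>y\<close> consists of \<open>x\<close>
    with \<open>p x + y \<in> K\<close>, and then \<open>x + y = (p x + y) + (x - p x)\<close> lies
    in \<open>U\<close>.\<close>
  have "emeasure (\<mu> \<Otimes>\<^sub>M \<nu>) E = (\<integral>\<^sup>+ y. emeasure \<mu> ((\<lambda>x. (x, y)) -` E) \<partial>\<nu>)"
    using E by (rule P.emeasure_pair_measure_alt2)
  also have "\<dots> \<le> (\<integral>\<^sup>+ y. emeasure \<mu> U \<partial>\<nu>)"
  proof (rule nn_integral_mono)
    fix y
    have "(\<lambda>x. (x, y)) -` E \<subseteq> (\<lambda>x. - y + x) ` U"
    proof
      fix x assume "x \<in> (\<lambda>x. (x, y)) -` E"
      then have "p x + y \<in> K" by (simp add: in_E)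
      then have "(p x + y) + (x - p x) \<in> U" using V(3) p(2) by blast
      then show "x \<in> (\<lambda>x. - y + x) ` U" unfolding plus_image_eq_vimage by (simp add: algebra_simps)
    qed
    then have "emeasure \<mu> ((\<lambda>x. (x, y)) -` E) \<le> emeasure \<mu> ((\<lambda>x. - y + x) ` U)"
      using borel_plus_image[OF Ub] by (intro emeasure_mono) (simp_all only: sM)
    also have "\<dots> = emeasure \<mu> U" using \<mu> Ub unfolding translation_invariant_def by metis
    finally show "emeasure \<mu> ((\<lambda>x. (x, y)) -` E) \<le> emeasure \<mu> U" .
  qed
  also have "\<dots> = emeasure \<mu> U" by (simp add: N.emeasure_space_1)
  finally show ?thesis using 1 by simp
qed


section \<open>Regularity and uniqueness of Haar measure\<close>

locale compact_haar =
  fixes \<mu> :: "'a::{topological_ab_group_add, t2_space} measure"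
  assumes haar: "haar_prob \<mu>" and compact_UNIV: "compact (UNIV :: 'a set)"
begin

sublocale prob_space \<mu> using haar by (simp add: haar_prob_def)

lemma sets_haar [measurable_cong, simp]: "sets \<mu> = sets borel"
  using haar by (simp add: haar_prob_def)

lemma space_haar [simp]: "space \<mu> = UNIV"
  using sets_eq_imp_space_eq[OF sets_haar] by simp

lemma measure_UNIV [simp]: "measure \<mu> UNIV = 1"
  using prob_space by simp

lemma measure_plus_image:
  assumes "A \<in> sets borel" shows "measure \<mu> ((\<lambda>x. g + x) ` A) = measure \<mu> A"
  using haar assms unfolding haar_prob_def measure_def by metis

lemma outer_regular:
  assumes "A \<in> sets borel" "e > 0"
  obtains U where "open U" "A \<subseteq> U" "measure \<mu> U < measure \<mu> A + e"
proof -
  have "emeasure \<mu> A = (INF U\<in>{U. open U \<and> A \<subseteq> U}. emeasure \<mu> U)"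
    using haar assms(1) unfolding haar_prob_def by metis
  moreover have "emeasure \<mu> A < ennreal (measure \<mu> A + e)"
    using assms(2) by (simp add: emeasure_eq_measure ennreal_less_iff)
  ultimately have "(INF U\<in>{U. open U \<and> A \<subseteq> U}. emeasure \<mu> U) < ennreal (measure \<mu> A + e)"
    by simp
  then obtain U where "open U" "A \<subseteq> U" "emeasure \<mu> U < ennreal (measure \<mu> A + e)"
    by (auto simp: INF_less_iff)
  then show thesis using that[of U]
    by (simp add: emeasure_eq_measure ennreal_less_iff)
qed

text \<open>\<open>haar_prob\<close> asks for inner regularity on open sets only. For Borel sets,
  the complement of an open superset of \<open>- A\<close> is closed, hence compact.\<close>

lemma inner_regular:
  assumes "A \<in> sets borel" "e > 0"
  obtains K where "compact K" "K \<subseteq> A" "measure \<mu> A - e < measure \<mu> K"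
proof -
  have "- A \<in> sets borel" using assms(1) by auto
  then obtain U where U: "open U" "- A \<subseteq> U" "measure \<mu> U < measure \<mu> (- A) + e"
    using assms(2) by (rule outer_regular)
  have "compact (- U)" using U(1) compact_UNIV
    by (metis compact_Int_closed Int_UNIV_left closed_Compl)
  moreover have "- U \<subseteq> A" using U(2) by auto
  moreover have "measure \<mu> (- U) = 1 - measure \<mu> U" "measure \<mu> (- A) = 1 - measure \<mu> A"
    using prob_compl[of U] prob_compl[of A] U(1) assms(1) by (auto simp: Compl_eq_Diff_UNIV)
  ultimately show thesis using that[of "- U"] U(3) by simp
qed

end

text \<open>Uniqueness of Haar measure: the image of \<open>\<mu>\<close> under \<open>\<pi>\<close>
  is invariant, so \<open>translation_invariant_le\<close> compares it with \<open>\<nu>\<close> in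
  both directions. Applied to coordinate projections and to negation.\<close>

lemma continuous_hom_measure_preserving:
  fixes \<mu> :: "'a::{topological_ab_group_add, t2_space} measure"
    and \<nu> :: "'b::{topological_ab_group_add, t2_space} measure"
  assumes c: "compact (UNIV :: 'a set)" and \<mu>: "haar_prob \<mu>" and \<nu>: "haar_prob \<nu>"
    and \<pi>: "continuous_on UNIV \<pi>" "\<And>x y. \<pi> (x + y) = \<pi> x + \<pi> y" "surj \<pi>"
    and A: "A \<in> sets borel"
  shows "measure \<mu> (\<pi> -` A) = measure \<nu> A"
proof -
  interpret M: compact_haar \<mu> using c \<mu> by unfold_locales
  have c': "compact (UNIV :: 'b set)"
    using compact_continuous_image[OF \<pi>(1) c] \<pi>(3) by simp
  interpret N: compact_haar \<nu> using c' \<nu> by unfold_locales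
  have \<pi>m [measurable]: "\<pi> \<in> borel_measurable borel"
    using \<pi>(1) by (rule borel_measurable_continuous_onI)
  then have \<pi>m' [measurable]: "\<pi> \<in> borel_measurable \<mu>" by simp
  let ?d = "distr \<mu> borel \<pi>"
  interpret D: prob_space ?d by (rule M.prob_space_distr) measurable
  have d: "measure ?d B = measure \<mu> (\<pi> -` B)" if "B \<in> sets borel" for B
    using that by (simp add: measure_distr)
  have vb: "\<pi> -` B \<in> sets borel" if "B \<in> sets borel" for B
    using measurable_sets[OF \<pi>m that] by simp
  have "translation_invariant ?d"
    unfolding translation_invariant_def
  proof (intro conjI allI ballI)
    show "prob_space ?d" by unfold_locales
    show "sets ?d = sets borel" by simp
    fix g and B :: "'b set" assume B: "B \<in> sets borel"
    obtain h where h: "g = \<pi> h" using \<pi>(3) by (metis surjD)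
    have m: "\<pi> (- h) = - g" using \<pi>(2)[of h "- h"] \<pi>(2)[of 0 0] h
      by (simp add: eq_neg_iff_add_eq_0 add.commute)
    have "\<pi> -` ((\<lambda>x. g + x) ` B) = (\<lambda>x. h + x) ` (\<pi> -` B)"
      unfolding plus_image_eq_vimage using \<pi>(2)[of "- h"] m by auto
    then have "measure ?d ((\<lambda>x. g + x) ` B) = measure ?d B"
      using B borel_plus_image[OF B, of g] vb[OF B] by (simp add: d M.measure_plus_image)
    then show "emeasure ?d ((\<lambda>x. g + x) ` B) = emeasure ?d B"
      by (simp add: D.emeasure_eq_measure)
  qed
  note ti = this
  have comp: "measure \<mu> (\<pi> -` K) = measure \<nu> K" if K: "compact K" for K
  proof (rule antisym)
    have Kb: "K \<in> sets borel" using K by (rule borel_compact)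
    show "measure \<mu> (\<pi> -` K) \<le> measure \<nu> K"
    proof (rule field_le_epsilon)
      fix e :: real assume "e > 0"
      with Kb obtain U where U: "open U" "K \<subseteq> U" "measure \<nu> U < measure \<nu> K + e"
        by (rule N.outer_regular)
      have "emeasure ?d K \<le> emeasure \<nu> U"
        by (rule translation_invariant_le[OF c' haar_imp_translation_invariant[OF \<nu>] ti K U(1,2)])
      then have "measure \<mu> (\<pi> -` K) \<le> measure \<nu> U"
        using d[OF Kb] by (simp add: D.emeasure_eq_measure N.emeasure_eq_measure)
      then show "measure \<mu> (\<pi> -` K) \<le> measure \<nu> K + e" using U(3) by simp
    qed
    show "measure \<nu> K \<le> measure \<mu> (\<pi> -` K)"
    proof (rule field_le_epsilon)
      fix e :: real assume "e > 0"
      with vb[OF Kb] obtain W where W: "open W" "\<pi> -` K \<subseteq> W" "measure \<mu> W < measure \<mu> (\<pi> -` K) + e"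
        by (rule M.outer_regular)
      \<comment> \<open>The largest set whose preimage lies in \<open>W\<close>; it is open because
        \<open>\<pi>\<close> is a closed map. Outer regularity of \<open>\<mu>\<close> thus replaces
        that of the image measure.\<close>
      define U where "U = - (\<pi> ` (- W))"
      have "compact (- W)" using W(1) c by (metis compact_Int_closed Int_UNIV_left closed_Compl)
      then have "compact (\<pi> ` (- W))"
        using \<pi>(1) by (meson compact_continuous_image continuous_on_subset subset_UNIV)
      then have U: "open U" unfolding U_def by (simp add: compact_imp_closed open_Compl)
      have KU: "K \<subseteq> U" unfolding U_def using W(2) by auto
      have UW: "\<pi> -` U \<subseteq> W" unfolding U_def by auto
      have "emeasure \<nu> K \<le> emeasure ?d U"
        by (rule translation_invariant_le[OF c' ti haar_imp_translation_invariant[OF \<nu>] K U KU])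
      then have "measure \<nu> K \<le> measure \<mu> (\<pi> -` U)"
        using d[of U] U by (simp add: D.emeasure_eq_measure N.emeasure_eq_measure)
      also have "\<dots> \<le> measure \<mu> W" using UW W(1) by (intro M.finite_measure_mono) auto
      finally show "measure \<nu> K \<le> measure \<mu> (\<pi> -` K) + e" using W(3) by simp
    qed
  qed
  have le: "measure \<nu> B \<le> measure \<mu> (\<pi> -` B)" if B: "B \<in> sets borel" for B
  proof (rule field_le_epsilon)
    fix e :: real assume "e > 0"
    with B obtain K where K: "compact K" "K \<subseteq> B" "measure \<nu> B - e < measure \<nu> K"
      by (rule N.inner_regular)
    have "measure \<mu> (\<pi> -` K) \<le> measure \<mu> (\<pi> -` B)"
      using K(2) vb[OF B] by (intro M.finite_measure_mono) auto
    then show "measure \<nu> B \<le> measure \<mu> (\<pi> -` B) + e" using K(3) comp[OF K(1)] by simp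
  qed
  \<comment> \<open>Both measures have mass 1, so the inequality for \<open>A\<close> and for
    \<open>- A\<close> forces equality.\<close>
  have "measure \<nu> (- A) = 1 - measure \<nu> A"
    using N.prob_compl[of A] A by (simp add: Compl_eq_Diff_UNIV)
  moreover have "measure \<mu> (\<pi> -` (- A)) = 1 - measure \<mu> (\<pi> -` A)"
    using M.prob_compl[of "\<pi> -` A"] vb[OF A] by (simp add: Compl_eq_Diff_UNIV vimage_Diff)
  ultimately show ?thesis using le[OF A] le[of "- A"] A by auto
qed

context compact_haar
begin

lemma measure_uminus_image:
  assumes "A \<in> sets borel" shows "measure \<mu> (uminus ` A) = measure \<mu> A"
  unfolding uminus_image_eq_vimage
  by (rule continuous_hom_measure_preserving[OF compact_UNIV haar haar _ _ _ assms])
    (auto intro!: continuous_intros surjI[of uminus uminus])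

lemma measure_open_pos:
  assumes "open U" "U \<noteq> {}" shows "measure \<mu> U > 0"
proof -
  obtain u where u: "u \<in> U" using assms by auto
  have "UNIV \<subseteq> (\<Union>c\<in>UNIV. (\<lambda>x. c + x) ` U)"
  proof
    fix x show "x \<in> (\<Union>c\<in>UNIV. (\<lambda>x. c + x) ` U)"
      using u by (intro UN_I[of "x - u"]) force+
  qed
  then obtain C where C: "finite C" "UNIV \<subseteq> (\<Union>c\<in>C. (\<lambda>x. c + x) ` U)"
    by (rule compactE_image[OF compact_UNIV, rotated]) (use open_plus_image[OF assms(1)] in auto)
  have "(\<Union>c\<in>C. (\<lambda>x. c + x) ` U) = UNIV" using C(2) by blast
  then have "1 = measure \<mu> (\<Union>c\<in>C. (\<lambda>x. c + x) ` U)" by simp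
  also have "\<dots> \<le> (\<Sum>c\<in>C. measure \<mu> ((\<lambda>x. c + x) ` U))"
    using C(1) borel_plus_image[of U] assms(1) by (intro finite_measure_subadditive_finite) auto
  also have "\<dots> = card C * measure \<mu> U" using assms(1) by (simp add: measure_plus_image)
  finally show ?thesis by (cases "measure \<mu> U = 0") (auto simp: zero_less_measure_iff)
qed

end

section \<open>The Kemperman--Scherk inequality\<close>

lemma open_diff_nhd:
  fixes U :: "'a::topological_ab_group_add set"
  assumes "open U" "0 \<in> U"
  obtains W where "open W" "0 \<in> W" "\<And>x y. x \<in> W \<Longrightarrow> y \<in> W \<Longrightarrow> x - y \<in> U"
proof -
  have "continuous_on UNIV (\<lambda>p::'a \<times> 'a. fst p - snd p)"
    by (intro continuous_intros)
  then have op: "open ((\<lambda>p::'a \<times> 'a. fst p - snd p) -` U)"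
    using assms(1) by (rule open_vimage[rotated])
  have "(0, 0) \<in> (\<lambda>p::'a \<times> 'a. fst p - snd p) -` U" using assms(2) by simp
  then obtain A B where AB: "open A" "open B" "(0,0) \<in> A \<times> B" "A \<times> B \<subseteq> (\<lambda>p. fst p - snd p) -` U"
    by (rule open_prod_elim[OF op])
  show thesis
    by (rule that[of "A \<inter> B"]) (use AB in auto)
qed

text \<open>By pigeonhole two multiples \<open>m b\<close> and \<open>n b\<close> with
  \<open>m < n\<close> are close, so \<open>(n - m - 1) b\<close> is close to \<open>- b\<close>.
  For the same reason a nonempty closed subsemigroup of a compact group is a group.\<close>

lemma uminus_mem_closed_multiples:
  fixes T :: "'a::topological_ab_group_add set"
  assumes c: "compact (UNIV :: 'a set)" and T: "closed T" "\<And>n::nat. (\<Sum>i<n. b) \<in> T"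
  shows "- b \<in> T"
proof (rule ccontr)
  assume b: "- b \<notin> T"
  let ?s = "\<lambda>n::nat. \<Sum>i<n. b"
  define U where "U = (\<lambda>x. - b + x) -` (- T)"
  have U: "open U" "0 \<in> U" unfolding U_def using T(1) b
    by (auto intro!: open_vimage continuous_intros)
  obtain W where W: "open W" "0 \<in> W" "\<And>x y. x \<in> W \<Longrightarrow> y \<in> W \<Longrightarrow> x - y \<in> U"
    using open_diff_nhd[OF U] by blast
  obtain p where p: "simple_function borel p" "\<And>x::'a. x - p x \<in> W"
    using simple_rounding[OF c W(1,2)] by blast
  have "finite (range p)" using simple_functionD(1)[OF p(1)] by simp
  then have "finite (range (\<lambda>n. p (?s n)))" by (rule rev_finite_subset) auto
  then have "\<not> inj (\<lambda>n. p (?s n))" using finite_imageD infinite_UNIV_nat by blast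
  then obtain m n where mn: "m < n" "p (?s m) = p (?s n)"
    unfolding inj_def by (metis nat_neq_iff)
  have "?s n - ?s m = (?s n - p (?s n)) - (?s m - p (?s m))" using mn(2) by simp
  also have "\<dots> \<in> U" using W(3) p(2) by blast
  finally have "- b + (?s n - ?s m) \<notin> T" by (simp add: U_def)
  moreover obtain k where k: "n = Suc (m + k)" using mn(1) less_iff_Suc_add by auto
  have "?s (m + j) = ?s m + ?s j" for j by (induction j) (auto simp: algebra_simps)
  then have "- b + (?s n - ?s m) = ?s k" by (simp add: k)
  ultimately show False using T(2)[of k] by simp
qed

context compact_haar
begin

lemma borel_section: "A \<in> sets borel \<Longrightarrow> {x. e + x \<in> A} \<in> sets borel" for A :: "'a set"
  using measurable_sets[OF borel_measurable_plus_const[of e], of A] by (simp add: vimage_def)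

lemma borel_uminus_section: "A \<in> sets borel \<Longrightarrow> {x. - x \<in> A} \<in> sets borel" for A :: "'a set"
  using measurable_sets[OF borel_measurable_uminus_group, of A] by (simp add: vimage_def)

text \<open>The part of \<open>B\<close> whose shift by \<open>e\<close> falls outside
  \<open>A\<close> is moved to \<open>A\<close>, hence the exact balance of measures. The sumset
  does not grow: for \<open>c \<in> B\<close> and \<open>b \<in> B'\<close>,
  \<open>(e + c) + b = (e + b) + c\<close> is again a sum from \<open>A\<close> and
  \<open>B\<close>.\<close>

lemma dyson_transform:
  assumes A: "A \<in> sets borel" and B: "B \<in> sets borel" and e: "e \<in> A"
  defines "A' \<equiv> A \<union> (\<lambda>x. e + x) ` B" and "B' \<equiv> {x \<in> B. e + x \<in> A}"
  shows "measure \<mu> A' + measure \<mu> B' = measure \<mu> A + measure \<mu> B"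
    and "measure \<mu> {x \<in> A'. - x \<in> B'} \<le> measure \<mu> {x \<in> A. - x \<in> B}"
proof -
  have B': "B' \<in> sets borel"
    unfolding B'_def using sets.Int[OF B borel_section[OF A]] by (simp add: Int_def)
  have A': "A' \<in> sets borel" unfolding A'_def using A borel_plus_image[OF B] by auto
  have "A' = A \<union> (\<lambda>x. e + x) ` (B - B')" "A \<inter> (\<lambda>x. e + x) ` (B - B') = {}"
    unfolding A'_def B'_def by auto
  then have "measure \<mu> A' = measure \<mu> A + measure \<mu> ((\<lambda>x. e + x) ` (B - B'))"
    using A B B' borel_plus_image[of "B - B'"] by (simp add: finite_measure_Union)
  also have "measure \<mu> ((\<lambda>x. e + x) ` (B - B')) = measure \<mu> B - measure \<mu> B'"
    using B B' by (subst measure_plus_image) (auto simp: B'_def intro!: finite_measure_Diff)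
  finally show "measure \<mu> A' + measure \<mu> B' = measure \<mu> A + measure \<mu> B" by simp
  define X where "X = {x \<in> A'. - x \<in> B'}"
  have X: "X \<in> sets borel"
    unfolding X_def using sets.Int[OF A' borel_uminus_section[OF B']] by (simp add: Int_def)
  have R: "{x \<in> A. - x \<in> B} \<in> sets borel"
    using sets.Int[OF A borel_uminus_section[OF B]] by (simp add: Int_def)
  \<comment> \<open>A representation \<open>x + (-x) = 0\<close> with \<open>x\<close> outside \<open>A\<close> has \<open>x = e + b\<close>, and \<open>(e - x) + b = 0\<close>
    is then a representation by \<open>A\<close> and \<open>B\<close>.\<close>
  let ?Y = "(\<lambda>x. e + x) ` uminus ` (X - A)"
  have Yb: "?Y \<in> sets borel" using X A by (intro borel_plus_image borel_uminus_image) auto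
  have "measure \<mu> ((X \<inter> A) \<union> (X - A)) = measure \<mu> (X \<inter> A) + measure \<mu> (X - A)"
    using X A by (intro finite_measure_Union) auto
  then have "measure \<mu> X = measure \<mu> (X \<inter> A) + measure \<mu> (X - A)"
    by (simp add: Int_Diff_Un)
  also have "measure \<mu> (X - A) = measure \<mu> ?Y"
    using X A borel_uminus_image[of "X - A"] by (simp add: measure_plus_image measure_uminus_image)
  also have "measure \<mu> (X \<inter> A) + measure \<mu> ?Y = measure \<mu> ((X \<inter> A) \<union> ?Y)"
    using X A Yb by (intro finite_measure_Union[symmetric]) (auto simp: X_def B'_def)
  also have "\<dots> \<le> measure \<mu> {x \<in> A. - x \<in> B}"
    using R by (intro finite_measure_mono) (auto simp: X_def B'_def A'_def)
  finally show "measure \<mu> {x \<in> A'. - x \<in> B'} \<le> measure \<mu> {x \<in> A. - x \<in> B}" unfolding X_def .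
qed

text \<open>Each \<open>e\<close> makes the new \<open>B\<close> nearly as small as possible, with
  slack \<open>1 / (n + 1)\<close> because the infimum need not be attained. This greedy choice
  makes the limit pair immune to further transforms. Taking \<open>e\<close> in \<open>A n\<close>
  keeps 0 in every \<open>B n\<close>.\<close>

lemma dyson_transform_sequence:
  assumes A0: "A0 \<in> sets borel" "0 \<in> A0" and B0: "B0 \<in> sets borel" "0 \<in> B0"
    and S: "\<And>a b. a \<in> A0 \<Longrightarrow> b \<in> B0 \<Longrightarrow> a + b \<in> S"
  obtains A B :: "nat \<Rightarrow> 'a set" where "A 0 = A0" "B 0 = B0"
    "\<And>n. A n \<in> sets borel" "\<And>n. B n \<in> sets borel" "\<And>n. 0 \<in> B n"
    "\<And>n a b. a \<in> A n \<Longrightarrow> b \<in> B n \<Longrightarrow> a + b \<in> S"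
    "incseq A" "decseq B"
    "\<And>n. measure \<mu> (A n) + measure \<mu> (B n) = measure \<mu> A0 + measure \<mu> B0"
    "\<And>n. measure \<mu> {x \<in> A n. - x \<in> B n} \<le> measure \<mu> {x \<in> A0. - x \<in> B0}"
    "\<And>n e. e \<in> A n \<Longrightarrow> measure \<mu> (B (Suc n)) \<le> measure \<mu> {x \<in> B n. e + x \<in> A n} + 1 / real (Suc n)"
proof -
  define good where "good = (\<lambda>(n::nat) (P :: 'a set \<times> 'a set). case P of (A, B) \<Rightarrow>
     (n = 0 \<longrightarrow> A = A0 \<and> B = B0) \<and>
     A \<in> sets borel \<and> B \<in> sets borel \<and> 0 \<in> A \<and> 0 \<in> B \<and> (\<forall>a\<in>A. \<forall>b\<in>B. a + b \<in> S) \<and>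
     measure \<mu> A + measure \<mu> B = measure \<mu> A0 + measure \<mu> B0 \<and>
     measure \<mu> {x \<in> A. - x \<in> B} \<le> measure \<mu> {x \<in> A0. - x \<in> B0})"
  define rel where "rel = (\<lambda>(n::nat) (P :: 'a set \<times> 'a set) P'. fst P \<subseteq> fst P' \<and> snd P' \<subseteq> snd P \<and>
     (\<forall>e\<in>fst P. measure \<mu> (snd P') \<le> measure \<mu> {x \<in> snd P. e + x \<in> fst P} + 1 / real (Suc n)))"
  have "\<exists>f. \<forall>n. good n (f n) \<and> rel n (f n) (f (Suc n))"
  proof (rule dependent_nat_choice)
    show "\<exists>x. good 0 x" using assms by (intro exI[of _ "(A0, B0)"]) (auto simp: good_def)
    fix P n assume g: "good n P"
    obtain A B where P: "P = (A, B)" by (cases P)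
    have A: "A \<in> sets borel" "0 \<in> A" and B: "B \<in> sets borel" "0 \<in> B"
      and AB: "\<And>a b. a \<in> A \<Longrightarrow> b \<in> B \<Longrightarrow> a + b \<in> S"
      and m1: "measure \<mu> A + measure \<mu> B = measure \<mu> A0 + measure \<mu> B0"
      and m2: "measure \<mu> {x \<in> A. - x \<in> B} \<le> measure \<mu> {x \<in> A0. - x \<in> B0}"
      using g by (auto simp: good_def P)
    let ?m = "\<lambda>e. measure \<mu> {x \<in> B. e + x \<in> A}"
    have bdd: "bdd_below (?m ` A)" by (intro bdd_belowI2[of _ 0]) auto
    have "(INF e\<in>A. ?m e) < (INF e\<in>A. ?m e) + 1 / real (Suc n)" by simp
    then obtain e where e: "e \<in> A" "?m e < (INF e\<in>A. ?m e) + 1 / real (Suc n)"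
      using cINF_less_iff[of A ?m] A(2) bdd by blast
    have e': "?m e \<le> ?m e' + 1 / real (Suc n)" if "e' \<in> A" for e'
      using e(2) cINF_lower[OF bdd that] by linarith
    let ?A = "A \<union> (\<lambda>x. e + x) ` B" and ?B = "{x \<in> B. e + x \<in> A}"
    have B'b: "?B \<in> sets borel"
      using sets.Int[OF B(1) borel_section[OF A(1)]] by (simp add: Int_def)
    have A'b: "?A \<in> sets borel" using A borel_plus_image[OF B(1)] by auto
    have sum: "a + b \<in> S" if ab: "a \<in> ?A" "b \<in> ?B" for a b
    proof (cases "a \<in> A")
      case True then show ?thesis using AB ab(2) by auto
    next
      case False
      then obtain c where c: "c \<in> B" "a = e + c" using ab(1) by auto
      have "(e + b) + c \<in> S" using AB ab(2) c(1) by auto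
      then show ?thesis by (simp add: c(2) algebra_simps)
    qed
    have "good (Suc n) (?A, ?B)"
      unfolding good_def split using A'b B'b sum A B e(1) m1 m2 dyson_transform[OF A(1) B(1) e(1)]
      by auto
    moreover have "rel n P (?A, ?B)"
      unfolding rel_def P using e' by auto
    ultimately show "\<exists>y. good (Suc n) y \<and> rel n P y" by blast
  qed
  then obtain f where f: "\<And>n. good n (f n)" "\<And>n. rel n (f n) (f (Suc n))" by blast
  have "good n (fst (f n), snd (f n))" for n using f(1)[of n] by simp
  note g = this[unfolded good_def prod.case]
  show thesis
  proof (rule that[of "\<lambda>n. fst (f n)" "\<lambda>n. snd (f n)"])
    show "incseq (\<lambda>n. fst (f n))" "decseq (\<lambda>n. snd (f n))"
      using f(2) by (auto simp: rel_def intro!: incseq_SucI decseq_SucI)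
  qed (use f(2) g g[of 0] in \<open>auto simp: rel_def\<close>)
qed


text \<open>If every point of a compact subset of positive measure had a neighbourhood meeting
  \<open>D\<close> in a null set, finitely many of these would cover that subset.\<close>

lemma support_point:
  assumes D: "D \<in> sets borel" "measure \<mu> D > 0"
  obtains b where "b \<in> D" "\<And>U. open U \<Longrightarrow> b \<in> U \<Longrightarrow> measure \<mu> (D \<inter> U) > 0"
proof -
  obtain C where C: "compact C" "C \<subseteq> D" "measure \<mu> D - measure \<mu> D < measure \<mu> C"
    using D by (rule inner_regular)
  have "\<exists>b\<in>C. \<forall>U. open U \<longrightarrow> b \<in> U \<longrightarrow> measure \<mu> (D \<inter> U) > 0"
  proof (rule ccontr)
    assume "\<not> ?thesis"
    then have "\<forall>b\<in>C. \<exists>U. open U \<and> b \<in> U \<and> measure \<mu> (D \<inter> U) = 0"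
      using measure_nonneg[of \<mu>] by (metis antisym_conv1)
    from bchoice[OF this] obtain U where
      U: "\<forall>b\<in>C. open (U b) \<and> b \<in> U b \<and> measure \<mu> (D \<inter> U b) = 0" ..
    then have "C \<subseteq> (\<Union>b\<in>C. U b)" by auto
    then obtain F where F: "F \<subseteq> C" "finite F" "C \<subseteq> (\<Union>b\<in>F. U b)"
      by (rule compactE_image[OF C(1), rotated]) (use U in auto)
    have DU: "D \<inter> U b \<in> sets borel" if "b \<in> F" for b using U F(1) that D(1) by auto
    have "measure \<mu> C \<le> measure \<mu> (\<Union>b\<in>F. D \<inter> U b)"
      using C(2) F(2,3) DU by (intro finite_measure_mono sets.finite_UN) auto
    also have "\<dots> \<le> (\<Sum>b\<in>F. measure \<mu> (D \<inter> U b))"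
      using F(2) DU by (intro finite_measure_subadditive_finite) auto
    also have "\<dots> = 0" using U F(1) by (intro sum.neutral) auto
    finally show False using C(3) by simp
  qed
  then show thesis using C(2) that by blast
qed

text \<open>The continuous form of the Kemperman--Scherk inequality
  \<open>\<bar>A + B\<bar> \<ge> \<bar>A\<bar> + \<bar>B\<bar> - r\<close>, where \<open>r\<close> is the number of representations of \<open>0\<close> in \<open>A + B\<close>.
  In the limit of the transforms, \<open>e + B \<subseteq> A\<close> holds up to null sets for all \<open>e \<in> A\<close>, so \<open>closure A\<close>
  is closed under adding support points of \<open>B\<close>, hence by compactness contains their negatives.\<close>

theorem kemperman_scherk:
  assumes S: "closed S" and A0: "A0 \<in> sets borel" "0 \<in> A0" and B0: "B0 \<in> sets borel" "0 \<in> B0"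
    and AB: "\<And>a b. a \<in> A0 \<Longrightarrow> b \<in> B0 \<Longrightarrow> a + b \<in> S"
  shows "measure \<mu> A0 + measure \<mu> B0 \<le> measure \<mu> S + measure \<mu> {x \<in> A0. - x \<in> B0}"
proof -
  obtain A B :: "nat \<Rightarrow> 'a set" where i: "A 0 = A0" "B 0 = B0"
    and Ab: "\<And>n. A n \<in> sets borel" and Bb: "\<And>n. B n \<in> sets borel" and z: "\<And>n. 0 \<in> B n"
    and S': "\<And>n a b. a \<in> A n \<Longrightarrow> b \<in> B n \<Longrightarrow> a + b \<in> S"
    and mono: "incseq A" "decseq B"
    and sum: "\<And>n. measure \<mu> (A n) + measure \<mu> (B n) = measure \<mu> A0 + measure \<mu> B0"
    and rep: "\<And>n. measure \<mu> {x \<in> A n. - x \<in> B n} \<le> measure \<mu> {x \<in> A0. - x \<in> B0}"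
    and opt: "\<And>n e. e \<in> A n \<Longrightarrow> measure \<mu> (B (Suc n)) \<le> measure \<mu> {x \<in> B n. e + x \<in> A n} + 1 / real (Suc n)"
    using dyson_transform_sequence[OF A0 B0 AB] by blast
  define A' where "A' = (\<Union>n. A n)"
  define B' where "B' = (\<Inter>n. B n)"
  have A'b: "A' \<in> sets borel" and B'b: "B' \<in> sets borel"
    unfolding A'_def B'_def using Ab Bb by (auto intro!: sets.countable_UN sets.countable_INT)
  have limA: "(\<lambda>n. measure \<mu> (A n)) \<longlonglongrightarrow> measure \<mu> A'"
    unfolding A'_def using Ab mono(1) by (intro finite_Lim_measure_incseq) auto
  have limB: "(\<lambda>n. measure \<mu> (B n)) \<longlonglongrightarrow> measure \<mu> B'"
    unfolding B'_def using Bb mono(2) by (intro finite_Lim_measure_decseq) auto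
  have sum': "measure \<mu> A' + measure \<mu> B' = measure \<mu> A0 + measure \<mu> B0"
    using tendsto_add[OF limA limB] unfolding sum by (simp add: LIMSEQ_const_iff)
  have Rb: "{x \<in> C. - x \<in> D} \<in> sets borel" if "C \<in> sets borel" "D \<in> sets borel" for C D :: "'a set"
    using sets.Int[OF that(1) borel_uminus_section[OF that(2)]] by (simp add: Int_def)
  have Tb: "{x \<in> C. e + x \<in> D} \<in> sets borel" if "C \<in> sets borel" "D \<in> sets borel" for C D :: "'a set" and e
    using sets.Int[OF that(1) borel_section[OF that(2)]] by (simp add: Int_def)
  have rep': "measure \<mu> {x \<in> A'. - x \<in> B'} \<le> measure \<mu> {x \<in> A0. - x \<in> B0}"
  proof (rule LIMSEQ_le_const2)
    have "(\<lambda>n. measure \<mu> {x \<in> A n. - x \<in> B'}) \<longlonglongrightarrow> measure \<mu> (\<Union>n. {x \<in> A n. - x \<in> B'})"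
      using mono(1) Rb[OF Ab B'b] by (intro finite_Lim_measure_incseq) (auto simp: incseq_def)
    also have "(\<Union>n. {x \<in> A n. - x \<in> B'}) = {x \<in> A'. - x \<in> B'}" unfolding A'_def by auto
    finally show "(\<lambda>n. measure \<mu> {x \<in> A n. - x \<in> B'}) \<longlonglongrightarrow> measure \<mu> {x \<in> A'. - x \<in> B'}" .
    have "measure \<mu> {x \<in> A n. - x \<in> B'} \<le> measure \<mu> {x \<in> A0. - x \<in> B0}" for n
    proof -
      have "measure \<mu> {x \<in> A n. - x \<in> B'} \<le> measure \<mu> {x \<in> A n. - x \<in> B n}"
        using Rb[OF Ab Bb] unfolding B'_def by (intro finite_measure_mono) auto
      then show ?thesis using rep[of n] by linarith
    qed
    then show "\<exists>N. \<forall>n\<ge>N. measure \<mu> {x \<in> A n. - x \<in> B'} \<le> measure \<mu> {x \<in> A0. - x \<in> B0}" by blast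
  qed
  \<comment> \<open>By near-minimality, \<open>B (n + 1)\<close> and hence \<open>B'\<close> exceeds
    in measure by at most \<open>1 / (n + 1)\<close> the part of \<open>B n\<close> that the shift
    by \<open>e\<close> keeps in \<open>A n\<close>. Now let \<open>n\<close> grow.\<close>
  have stuck: "measure \<mu> {x \<in> B'. e + x \<notin> A'} = 0" if e: "e \<in> A'" for e
  proof -
    obtain N where N: "e \<in> A N" using e unfolding A'_def by auto
    have "(\<lambda>n. measure \<mu> {x \<in> B n. e + x \<in> A'}) \<longlonglongrightarrow> measure \<mu> (\<Inter>n. {x \<in> B n. e + x \<in> A'})"
      using mono(2) Tb[OF Bb A'b] by (intro finite_Lim_measure_decseq) (auto simp: decseq_def)
    also have "(\<Inter>n. {x \<in> B n. e + x \<in> A'}) = {x \<in> B'. e + x \<in> A'}" unfolding B'_def by auto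
    finally have "(\<lambda>n. measure \<mu> {x \<in> B n. e + x \<in> A'} + 1 / real (Suc n)) \<longlonglongrightarrow>
        measure \<mu> {x \<in> B'. e + x \<in> A'} + 0"
      by (intro tendsto_add LIMSEQ_inverse_real_of_nat[unfolded inverse_eq_divide])
    moreover have "measure \<mu> B' \<le> measure \<mu> {x \<in> B n. e + x \<in> A'} + 1 / real (Suc n)" if "n \<ge> N" for n
    proof -
      have "e \<in> A n" using N mono(1) that by (auto simp: incseq_def)
      have "measure \<mu> B' \<le> measure \<mu> (B (Suc n))"
        unfolding B'_def using Bb by (intro finite_measure_mono) auto
      also have "\<dots> \<le> measure \<mu> {x \<in> B n. e + x \<in> A n} + 1 / real (Suc n)" by (rule opt) fact
      also have "measure \<mu> {x \<in> B n. e + x \<in> A n} \<le> measure \<mu> {x \<in> B n. e + x \<in> A'}"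
        using Tb[OF Bb A'b] unfolding A'_def by (intro finite_measure_mono) auto
      finally show ?thesis by simp
    qed
    ultimately have "measure \<mu> B' \<le> measure \<mu> {x \<in> B'. e + x \<in> A'} + 0"
      by (intro LIMSEQ_le_const) blast+
    moreover have "measure \<mu> (B' - {x \<in> B'. e + x \<in> A'}) = measure \<mu> B' - measure \<mu> {x \<in> B'. e + x \<in> A'}"
      using B'b Tb[OF B'b A'b] by (intro finite_measure_Diff) auto
    moreover have "B' - {x \<in> B'. e + x \<in> A'} = {x \<in> B'. e + x \<notin> A'}" by auto
    ultimately show ?thesis using measure_nonneg[of \<mu> "{x \<in> B'. e + x \<notin> A'}"] by simp
  qed
  define T where "T = closure A'"
  have AT: "A' \<subseteq> T" unfolding T_def by (rule closure_subset)
  have TS: "T \<subseteq> S"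
    unfolding T_def
  proof (rule closure_minimal[OF _ S], rule subsetI)
    fix a assume "a \<in> A'"
    then obtain n where "a \<in> A n" unfolding A'_def by auto
    then show "a \<in> S" using S'[of a n 0] z[of n] by simp
  qed
  have T0: "0 \<in> T" using AT A0(2) i(1) unfolding A'_def by blast
  \<comment> \<open>The only obstruction to \<open>- B' \<subseteq> T\<close>; it turns out to be
    null.\<close>
  define D where "D = {x \<in> B'. - x \<notin> T}"
  have Db: "D \<in> sets borel"
  proof -
    have "- T \<in> sets borel" unfolding T_def by auto
    then show ?thesis
      using sets.Int[OF B'b borel_uminus_section[of "- T"]] by (simp add: D_def Int_def)
  qed
  have D0: "measure \<mu> D = 0"
  proof (rule ccontr)
    assume "measure \<mu> D \<noteq> 0"
    then have "measure \<mu> D > 0" by (simp add: zero_less_measure_iff)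
    from support_point[OF Db this] obtain b where
      b: "b \<in> D" "\<And>U. open U \<Longrightarrow> b \<in> U \<Longrightarrow> measure \<mu> (D \<inter> U) > 0" by blast
    \<comment> \<open>Otherwise some \<open>a\<close> of \<open>A'\<close> near \<open>t\<close> and
      a neighbourhood \<open>Q\<close> of \<open>b\<close> have \<open>a + Q\<close> outside
      \<open>T\<close>, yet \<open>Q\<close> meets \<open>D\<close> in positive measure, against
      \<open>stuck\<close>.\<close>
    have step: "t + b \<in> T" if t: "t \<in> T" for t
    proof (rule ccontr)
      assume tb: "t + b \<notin> T"
      have op: "open ((\<lambda>p::'a \<times> 'a. fst p + snd p) -` (- T))"
        using continuous_on_plus_pair by (rule open_vimage[rotated]) (simp add: T_def open_Compl)
      have "(t, b) \<in> (\<lambda>p::'a \<times> 'a. fst p + snd p) -` (- T)" using tb by simp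
      then obtain P Q where PQ: "open P" "open Q" "(t, b) \<in> P \<times> Q"
        "P \<times> Q \<subseteq> (\<lambda>p. fst p + snd p) -` (- T)" by (rule open_prod_elim[OF op])
      obtain a where a: "a \<in> A'" "a \<in> P"
        using t PQ(1,3) unfolding T_def by (auto simp: closure_iff_nhds_not_empty)
      have "a + x \<notin> T" if "x \<in> Q" for x using subsetD[OF PQ(4), of "(a, x)"] a(2) that by simp
      then have "D \<inter> Q \<subseteq> {x \<in> B'. a + x \<notin> A'}" using AT unfolding D_def by auto
      moreover have "{x \<in> B'. a + x \<notin> A'} \<in> sets borel"
        using Tb[OF B'b, of "- A'" a] A'b by auto
      ultimately have "measure \<mu> (D \<inter> Q) \<le> measure \<mu> {x \<in> B'. a + x \<notin> A'}"
        by (intro finite_measure_mono) auto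
      then show False using stuck[OF a(1)] b(2)[of Q] PQ by auto
    qed
    have "(\<Sum>i<n. b) \<in> T" for n :: nat
      using T0 step by (induction n) auto
    then have "- b \<in> T" by (intro uminus_mem_closed_multiples[OF compact_UNIV]) (simp_all add: T_def)
    then show False using b(1) by (simp add: D_def)
  qed
  have Nb: "uminus ` B' \<in> sets borel" "uminus ` D \<in> sets borel" using B'b Db by (auto intro: borel_uminus_image)
  have eq: "{x \<in> A'. - x \<in> B'} = A' \<inter> uminus ` B'" by (force simp: uminus_image_eq_vimage)
  \<comment> \<open>Apart from \<open>- D\<close>, both \<open>A'\<close> and \<open>- B'\<close>
    lie in \<open>T \<subseteq> S\<close>, and their intersection is the set of representations of
    0, so inclusion-exclusion gives the bound.\<close>
  have "measure \<mu> A' + measure \<mu> (uminus ` B') = measure \<mu> (A' \<union> uminus ` B') + measure \<mu> (A' \<inter> uminus ` B')"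
    using A'b Nb by (subst measure_Un3) (auto simp: fmeasurable_eq_sets)
  also have "measure \<mu> (A' \<union> uminus ` B') \<le> measure \<mu> (S \<union> uminus ` D)"
    using S Nb AT TS by (intro finite_measure_mono) (auto simp: D_def)
  also have "\<dots> \<le> measure \<mu> S + measure \<mu> (uminus ` D)"
    using S Nb by (intro measure_Un_le) auto
  finally show ?thesis
    using rep' sum' D0 Db B'b unfolding eq by (simp add: measure_uminus_image)
qed

end

section \<open>Sumsets and connectedness\<close>

lemma compact_set_plus:
  fixes A B :: "'a::topological_monoid_add set"
  assumes "compact A" "compact B" shows "compact (A + B)"
proof -
  have "A + B = (\<lambda>p. fst p + snd p) ` (A \<times> B)" by (force simp: set_plus_def)
  then show ?thesis
    using compact_continuous_image[OF continuous_on_subset[OF continuous_on_plus_pair] compact_Times[OF assms]]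
    by simp
qed

lemma open_set_plus_left:
  fixes A B :: "'a::topological_ab_group_add set"
  assumes "open A" shows "open (A + B)"
proof -
  have "A + B = (\<Union>b\<in>B. (\<lambda>x. b + x) ` A)" by (force simp: set_plus_def add.commute)
  then show ?thesis using open_plus_image[OF assms] by auto
qed

lemma compact_inter_reflection:
  fixes A B :: "'a::{topological_ab_group_add, t2_space} set"
  assumes "compact A" "compact B" shows "compact {x \<in> A. c - x \<in> B}"
proof -
  have "{x \<in> A. c - x \<in> B} = A \<inter> (\<lambda>x. c - x) -` B" by auto
  moreover have "closed ((\<lambda>x. c - x) -` B)"
    using compact_imp_closed[OF assms(2)] by (rule closed_vimage) (intro continuous_intros)
  ultimately show ?thesis using assms(1) by (simp add: compact_Int_closed)
qed

lemma sumset_pow_Suc: "sumset_pow (Suc n) A = sumset_pow n A + A"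
proof (intro set_eqI iffI)
  fix x assume "x \<in> sumset_pow (Suc n) A"
  then obtain a where a: "\<forall>i<Suc n. a i \<in> A" "x = (\<Sum>i<Suc n. a i)" unfolding sumset_pow_def by auto
  then have "(\<Sum>i<n. a i) \<in> sumset_pow n A" "a n \<in> A" unfolding sumset_pow_def by auto
  then show "x \<in> sumset_pow n A + A" using a(2) by auto
next
  fix x assume "x \<in> sumset_pow n A + A"
  then obtain a c where a: "\<forall>i<n. a i \<in> A" "x = (\<Sum>i<n. a i) + c" "c \<in> A"
    unfolding sumset_pow_def set_plus_def by auto
  then have "x = (\<Sum>i<Suc n. (a(n := c)) i)" "\<forall>i<Suc n. (a(n := c)) i \<in> A" by (auto simp: less_Suc_eq)
  then show "x \<in> sumset_pow (Suc n) A" unfolding sumset_pow_def by blast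
qed

lemma sumset_pow_0: "sumset_pow 0 A = {0}"
  by (auto simp: sumset_pow_def)

lemma compact_sumset_pow:
  fixes A :: "'a::topological_ab_group_add set"
  shows "compact A \<Longrightarrow> compact (sumset_pow n A)"
  by (induction n) (auto simp: sumset_pow_0 sumset_pow_Suc compact_set_plus)

section \<open>Sums of small measure are open\<close>

context compact_haar
begin

text \<open>For small \<open>v\<close>, disjoint \<open>E\<close> and \<open>E + v\<close> would
  both fit into an open set of measure below twice that of \<open>E\<close>.\<close>

lemma steinhaus:
  assumes E: "compact E" "measure \<mu> E > 0"
  obtains N where "open N" "0 \<in> N" "\<And>v. v \<in> N \<Longrightarrow> \<exists>x\<in>E. x + v \<in> E"
proof -
  have Eb: "E \<in> sets borel" using E(1) by (rule borel_compact)
  obtain U where U: "open U" "E \<subseteq> U" "measure \<mu> U < measure \<mu> E + measure \<mu> E"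
    using Eb E(2) by (rule outer_regular)
  obtain N where N: "open N" "0 \<in> N" "\<And>x v. x \<in> E \<Longrightarrow> v \<in> N \<Longrightarrow> x + v \<in> U"
    using compact_plus_nhd_subset[OF E(1) U(1,2)] by blast
  have "\<exists>x\<in>E. x + v \<in> E" if v: "v \<in> N" for v
  proof (rule ccontr)
    assume "\<not> ?thesis"
    then have "E \<inter> (\<lambda>x. v + x) ` E = {}" by (auto simp: add.commute)
    then have "measure \<mu> (E \<union> (\<lambda>x. v + x) ` E) = measure \<mu> E + measure \<mu> E"
      using Eb borel_plus_image[OF Eb] by (simp add: finite_measure_Union measure_plus_image)
    moreover have "measure \<mu> (E \<union> (\<lambda>x. v + x) ` E) \<le> measure \<mu> U"
    proof (rule finite_measure_mono)
      show "E \<union> (\<lambda>x. v + x) ` E \<subseteq> U" using U(2) N(3)[OF _ v] by (auto simp: add.commute)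
      show "U \<in> sets \<mu>" using U(1) by simp
    qed
    ultimately show False using U(3) by simp
  qed
  then show thesis using N(1,2) that by blast
qed

text \<open>Shifting by \<open>- p\<close> and \<open>- q\<close> with \<open>c = p + q\<close>
  turns the representations of \<open>c\<close> into representations of 0.\<close>

lemma kemperman_compact:
  assumes A: "compact A" and B: "compact B" and c: "c \<in> A + B"
  shows "measure \<mu> A + measure \<mu> B \<le> measure \<mu> (A + B) + measure \<mu> {x \<in> A. c - x \<in> B}"
proof -
  have b: "A \<in> sets borel" "B \<in> sets borel" "A + B \<in> sets borel"
    using A B compact_set_plus[OF A B] by (auto intro: borel_compact)
  obtain p q where pq: "p \<in> A" "q \<in> B" "c = p + q" using c by (auto simp: set_plus_def)
  let ?A = "(\<lambda>x. - p + x) ` A" and ?B = "(\<lambda>x. - q + x) ` B" and ?S = "(\<lambda>x. - c + x) ` (A + B)"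
  have S: "closed ?S"
    using compact_set_plus[OF A B]
    by (intro compact_imp_closed compact_continuous_image continuous_intros)
  have R: "{x \<in> A. c - x \<in> B} \<in> sets borel"
    using compact_inter_reflection[OF A B] by (rule borel_compact)
  have eq: "{x \<in> ?A. - x \<in> ?B} = (\<lambda>x. - p + x) ` {x \<in> A. c - x \<in> B}"
    unfolding plus_image_eq_vimage pq(3) by (auto simp: algebra_simps)
  have "measure \<mu> ?A + measure \<mu> ?B \<le> measure \<mu> ?S + measure \<mu> {x \<in> ?A. - x \<in> ?B}"
  proof (rule kemperman_scherk[OF S])
    show "?A \<in> sets borel" "?B \<in> sets borel" using b by (auto simp only: intro!: borel_plus_image)
    show "0 \<in> ?A" "0 \<in> ?B" using pq by (auto simp: image_iff)
    fix a b assume "a \<in> ?A" "b \<in> ?B"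
    then obtain x y where "a = - p + x" "b = - q + y" "x \<in> A" "y \<in> B" by auto
    then have "a + b = - c + (x + y)" "x + y \<in> A + B" using pq(3) by (auto simp: algebra_simps)
    then show "a + b \<in> ?S" by blast
  qed
  then show ?thesis unfolding eq using b R by (simp only: measure_plus_image)
qed

text \<open>Plays the part of Kneser's theorem. In case of a deficit, the set \<open>E\<close> of
  representations of any \<open>s\<close> has positive measure, and \<open>s + (E - E)\<close> lies
  in \<open>A + B\<close>: \<open>x + v\<close> from \<open>A\<close> is paired with
  \<open>s - x\<close> from \<open>B\<close>.\<close>

theorem open_set_plus_or_measure_le:
  assumes A: "compact A" and B: "compact B"
  shows "open (A + B) \<or> measure \<mu> A + measure \<mu> B \<le> measure \<mu> (A + B)"
proof (rule disjCI)
  assume n: "\<not> measure \<mu> A + measure \<mu> B \<le> measure \<mu> (A + B)"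
  have "\<exists>T. open T \<and> s \<in> T \<and> T \<subseteq> A + B" if s: "s \<in> A + B" for s
  proof -
    let ?E = "{x \<in> A. s - x \<in> B}"
    have pos: "measure \<mu> ?E > 0" using kemperman_compact[OF A B s] n by linarith
    obtain N where N: "open N" "0 \<in> N" "\<And>v. v \<in> N \<Longrightarrow> \<exists>x\<in>?E. x + v \<in> ?E"
      using steinhaus[OF compact_inter_reflection[OF A B] pos] by blast
    have "(\<lambda>x. s + x) ` N \<subseteq> A + B"
    proof
      fix y assume "y \<in> (\<lambda>x. s + x) ` N"
      then obtain v x where "y = s + v" "x \<in> ?E" "x + v \<in> ?E" using N(3) by blast
      then have "y = (x + v) + (s - x)" "x + v \<in> A" "s - x \<in> B" by auto
      then show "y \<in> A + B" by blast
    qed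
    then show ?thesis using open_plus_image[OF N(1), of s] N(2)
      by (intro exI[of _ "(\<lambda>x. s + x) ` N"]) force
  qed
  then show "open (A + B)" by (subst open_subopen) blast
qed

text \<open>An open summand makes every later sum open, so superadditivity holds at all steps unless
  openness has been reached.\<close>

lemma open_sumset_pow_or_measure_le:
  assumes K: "compact K"
  shows "open (sumset_pow n K) \<or> real n * measure \<mu> K \<le> measure \<mu> (sumset_pow n K)"
proof (induction n)
  case (Suc n)
  then show ?case
  proof
    assume "open (sumset_pow n K)"
    then show ?thesis by (simp add: sumset_pow_Suc open_set_plus_left)
  next
    assume "real n * measure \<mu> K \<le> measure \<mu> (sumset_pow n K)"
    then show ?thesis
      using open_set_plus_or_measure_le[OF compact_sumset_pow[OF K, of n] K]
      by (auto simp: sumset_pow_Suc algebra_simps)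
  qed
qed auto

theorem sum_free_modulo_connected:
  assumes K: "compact K" "sum_free k l K" "1 < real (k + l) * measure \<mu> K"
    and C: "connected C" "0 \<in> C"
    and ab: "a \<in> sumset_pow k K" "b \<in> sumset_pow l K"
  shows "b - a \<notin> C"
proof
  assume baC: "b - a \<in> C"
  let ?P = "sumset_pow l K" and ?Q = "uminus ` sumset_pow k K"
  have P: "compact ?P" and Q: "compact ?Q"
    using compact_sumset_pow[OF K(1)] by (auto intro!: compact_continuous_image continuous_intros)
  have Qm: "measure \<mu> ?Q = measure \<mu> (sumset_pow k K)"
    using borel_compact[OF compact_sumset_pow[OF K(1)]] by (rule measure_uminus_image)
  have "open (?P + ?Q)"
  proof (rule ccontr)
    assume no: "\<not> open (?P + ?Q)"
    have "\<not> open ?P" using no open_set_plus_left[of ?P ?Q] by blast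
    moreover have "\<not> open (sumset_pow k K)"
    proof
      assume "open (sumset_pow k K)"
      then have "open ?Q" unfolding uminus_image_eq_vimage by (rule open_vimage) (intro continuous_intros)
      then show False using no open_set_plus_left[of ?Q ?P] by (simp add: add.commute)
    qed
    ultimately have "real l * measure \<mu> K + real k * measure \<mu> K \<le> measure \<mu> ?P + measure \<mu> ?Q"
      using open_sumset_pow_or_measure_le[OF K(1), of l] open_sumset_pow_or_measure_le[OF K(1), of k] Qm
      by simp
    also have "\<dots> \<le> measure \<mu> (?P + ?Q)" using open_set_plus_or_measure_le[OF P Q] no by blast
    also have "\<dots> \<le> 1" by simp
    finally show False using K(3) by (simp add: algebra_simps)
  qed
  moreover have "closed (?P + ?Q)" using compact_set_plus[OF P Q] by (rule compact_imp_closed)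
  moreover have "b + (- a) \<in> ?P + ?Q" using ab by blast
  moreover have "0 \<notin> ?P + ?Q"
  proof
    assume "0 \<in> ?P + ?Q"
    then obtain x y where "x \<in> ?P" "y \<in> sumset_pow k K" "0 = x + - y" by (auto simp: set_plus_def)
    then show False using K(2) unfolding sum_free_def by auto
  qed
  ultimately show False
    using connectedD[OF C(1), of "?P + ?Q" "- (?P + ?Q)"] C(2) baC by auto
qed

end

section \<open>Convolution of continuous functions\<close>

lemma uniform_continuity_group:
  fixes g :: "'a::topological_ab_group_add \<Rightarrow> 'b::metric_space"
  assumes c: "compact (UNIV :: 'a set)" and g: "continuous_on UNIV g" and e: "e > 0"
  obtains V where "open V" "0 \<in> V" "\<And>x v. v \<in> V \<Longrightarrow> dist (g (x + v)) (g x) < e"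
proof -
  let ?W = "(\<lambda>p::'a \<times> 'a. dist (g (snd p + fst p)) (g (snd p))) -` {..<e}"
  have "continuous_on UNIV (\<lambda>p::'a \<times> 'a. dist (g (snd p + fst p)) (g (snd p)))"
    by (intro continuous_intros continuous_on_compose2[OF g]) auto
  then have "open ?W" by (rule open_vimage[rotated]) simp
  moreover have "{0} \<times> UNIV \<subseteq> ?W" using e by auto
  ultimately obtain V where V: "0 \<in> V" "open V" "V \<times> UNIV \<subseteq> ?W"
    using Elementary_Topology.tube_lemma[OF c, of ?W 0] by blast
  have "dist (g (x + v)) (g x) < e" if "v \<in> V" for x v
    using subsetD[OF V(3), of "(v, x)"] that by simp
  then show thesis using V that by blast
qed

context compact_haar
begin

lemma continuous_bounded:
  fixes f :: "'a \<Rightarrow> 'b::real_normed_vector"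
  assumes "continuous_on UNIV f"
  obtains B where "B > 0" "\<And>x. norm (f x) \<le> B"
proof -
  have "compact (f ` UNIV)" using assms compact_UNIV by (rule compact_continuous_image)
  then have "bounded (f ` UNIV)" by (rule compact_imp_bounded)
  then show thesis using that unfolding bounded_pos by auto
qed

lemma continuous_measurable [measurable_dest]:
  fixes f :: "'a \<Rightarrow> 'b::topological_space"
  shows "continuous_on UNIV f \<Longrightarrow> f \<in> borel_measurable borel"
  by (rule borel_measurable_continuous_onI)

lemma continuous_integrable:
  fixes f :: "'a \<Rightarrow> 'b::{banach, second_countable_topology}"
  assumes "continuous_on UNIV f" shows "integrable \<mu> f"
proof -
  obtain B where "\<And>x. norm (f x) \<le> B" using continuous_bounded[OF assms] by blast
  then show ?thesis using continuous_measurable[OF assms]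
    by (intro integrable_const_bound[of _ B]) auto
qed

lemma distr_plus: "distr \<mu> borel (\<lambda>x. c + x) = \<mu>"
proof (rule measure_eqI)
  fix A :: "'a set" assume "A \<in> sets (distr \<mu> borel (\<lambda>x. c + x))"
  then have A: "A \<in> sets borel" by simp
  have "emeasure (distr \<mu> borel (\<lambda>x. c + x)) A = emeasure \<mu> ((\<lambda>x. c + x) -` A)"
    using A by (subst emeasure_distr) auto
  also have "(\<lambda>x. c + x) -` A = (\<lambda>x. - c + x) ` A" unfolding plus_image_eq_vimage by simp
  also have "emeasure \<mu> \<dots> = emeasure \<mu> A" by (simp only: emeasure_eq_measure measure_plus_image[OF A])
  finally show "emeasure (distr \<mu> borel (\<lambda>x. c + x)) A = emeasure \<mu> A" .
qed simp

lemma distr_uminus: "distr \<mu> borel uminus = \<mu>"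
proof (rule measure_eqI)
  fix A :: "'a set" assume "A \<in> sets (distr \<mu> borel uminus)"
  then have A: "A \<in> sets borel" by simp
  have "emeasure (distr \<mu> borel uminus) A = emeasure \<mu> (uminus -` A)"
    using A by (subst emeasure_distr) auto
  also have "\<dots> = emeasure \<mu> A"
    by (simp only: uminus_image_eq_vimage[symmetric] emeasure_eq_measure measure_uminus_image[OF A])
  finally show "emeasure (distr \<mu> borel uminus) A = emeasure \<mu> A" .
qed simp

lemma integral_plus:
  fixes f :: "'a \<Rightarrow> 'b::{banach, second_countable_topology}"
  assumes "continuous_on UNIV f" shows "(LINT x|\<mu>. f (c + x)) = (LINT x|\<mu>. f x)"
  using integral_distr[of "\<lambda>x. c + x" \<mu> borel f] continuous_measurable[OF assms] by (simp add: distr_plus)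

lemma integral_uminus:
  fixes f :: "'a \<Rightarrow> 'b::{banach, second_countable_topology}"
  assumes "continuous_on UNIV f" shows "(LINT x|\<mu>. f (- x)) = (LINT x|\<mu>. f x)"
  using integral_distr[of uminus \<mu> borel f] continuous_measurable[OF assms] by (simp add: distr_uminus)

lemma integral_reflect:
  fixes f :: "'a \<Rightarrow> 'b::{banach, second_countable_topology}"
  assumes "continuous_on UNIV f" shows "(LINT x|\<mu>. f (c - x)) = (LINT x|\<mu>. f x)"
proof -
  have "continuous_on UNIV (\<lambda>x. f (c + x))"
    by (intro continuous_on_compose2[OF assms] continuous_intros) auto
  from integral_uminus[OF this] show ?thesis using integral_plus[OF assms] by simp
qed

text \<open>Subtraction need not be measurable for the product \<open>\<sigma>\<close>-algebra, but its composition with a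
  continuous function is a uniform limit of functions that are.\<close>

lemma measurable_continuous_diff:
  fixes g :: "'a \<Rightarrow> complex"
  assumes g: "continuous_on UNIV g"
  shows "(\<lambda>(x, y). g (x - y)) \<in> borel_measurable (\<mu> \<Otimes>\<^sub>M \<mu>)"
proof -
  have "\<exists>p. simple_function borel p \<and> (\<forall>x y. dist (g (p x - y)) (g (x - y)) < 1 / real (Suc n))" for n
  proof -
    have "1 / real (Suc n) > 0" by simp
    then obtain V where V: "open V" "0 \<in> V" "\<And>x v. v \<in> V \<Longrightarrow> dist (g (x + v)) (g x) < 1 / real (Suc n)"
      using uniform_continuity_group[OF compact_UNIV g] by blast
    obtain p where p: "simple_function borel p" "\<And>x. x - p x \<in> V"
      using simple_rounding[OF compact_UNIV V(1,2)] by blast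
    have "dist (g (p x - y)) (g (x - y)) < 1 / real (Suc n)" for x y
      using V(3)[OF p(2)[of x], of "p x - y"] by (simp add: dist_commute algebra_simps)
    then show ?thesis using p(1) by blast
  qed
  then have "\<forall>n. \<exists>p. simple_function borel p \<and> (\<forall>x y. dist (g (p x - y)) (g (x - y)) < 1 / real (Suc n))"
    by blast
  from choice[OF this] obtain p where p: "\<And>n. simple_function borel (p n)"
    "\<And>n x y. dist (g (p n x - y)) (g (x - y)) < 1 / real (Suc n)" by blast
  show ?thesis
  proof (rule borel_measurable_LIMSEQ_metric)
    fix n
    have fin: "finite (range (p n))" using simple_functionD(1)[OF p(1)[of n]] by simp
    have [measurable]: "p n -` {c} \<in> sets borel" for c
      using simple_functionD(2)[OF p(1)[of n], of "{c}"] by simp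
    have [measurable]: "(\<lambda>y. g (c - y)) \<in> borel_measurable borel" for c
      by (intro continuous_measurable continuous_on_compose2[OF g] continuous_intros) auto
    have "(\<lambda>(x, y). g (p n x - y)) = (\<lambda>z. \<Sum>c\<in>range (p n). indicator (p n -` {c}) (fst z) *\<^sub>R g (c - snd z))"
    proof (intro ext, clarify)
      fix x y
      have "(\<Sum>c\<in>range (p n). indicator (p n -` {c}) (fst (x, y)) *\<^sub>R g (c - snd (x, y)))
          = (\<Sum>c\<in>range (p n). if p n x = c then g (c - y) else 0)"
        by (intro sum.cong) (auto simp: indicator_def)
      also have "\<dots> = g (p n x - y)" using fin by simp
      finally show "g (p n x - y) = (\<Sum>c\<in>range (p n). indicator (p n -` {c}) (fst (x, y)) *\<^sub>R g (c - snd (x, y)))" ..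
    qed
    moreover have "(\<lambda>z. \<Sum>c\<in>range (p n). indicator (p n -` {c}) (fst z) *\<^sub>R g (c - snd z)) \<in> borel_measurable (\<mu> \<Otimes>\<^sub>M \<mu>)"
      by measurable
    ultimately show "(\<lambda>(x, y). g (p n x - y)) \<in> borel_measurable (\<mu> \<Otimes>\<^sub>M \<mu>)" by simp
  next
    fix z :: "'a \<times> 'a"
    obtain x y where z: "z = (x, y)" by (cases z)
    have "(\<lambda>n. g (p n x - y)) \<longlonglongrightarrow> g (x - y)"
    proof (rule tendsto_dist_iff[THEN iffD2], 
        rule tendsto_sandwich[where f = "\<lambda>_. 0" and h = "\<lambda>n. 1 / real (Suc n)"])
      show "(\<lambda>n. 1 / real (Suc n)) \<longlonglongrightarrow> 0" using LIMSEQ_inverse_real_of_nat by (simp add: inverse_eq_divide)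
      show "(\<lambda>n. 0::real) \<longlonglongrightarrow> 0" by simp
      show "\<forall>\<^sub>F n in sequentially. 0 \<le> dist (g (p n x - y)) (g (x - y))" by simp
      show "\<forall>\<^sub>F n in sequentially. dist (g (p n x - y)) (g (x - y)) \<le> 1 / real (Suc n)"
        using p(2) by (intro always_eventually allI less_imp_le)
    qed
    then show "(\<lambda>n. case z of (x, y) \<Rightarrow> g (p n x - y)) \<longlonglongrightarrow> (case z of (x, y) \<Rightarrow> g (x - y))" by (simp add: z)
  qed
qed

definition conv :: "('a \<Rightarrow> complex) \<Rightarrow> ('a \<Rightarrow> complex) \<Rightarrow> 'a \<Rightarrow> complex" where
  "conv f g x = (LINT y|\<mu>. f y * g (x - y))"

text \<open>The involution of the convolution algebra: when \<open>adj f = f\<close>, convolution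
  with \<open>f\<close> is a self-adjoint operator.\<close>

definition adj :: "('a \<Rightarrow> complex) \<Rightarrow> 'a \<Rightarrow> complex" where
  "adj f x = cnj (f (- x))"

definition sqnorm :: "('a \<Rightarrow> complex) \<Rightarrow> real" where
  "sqnorm f = (LINT x|\<mu>. (norm (f x))\<^sup>2)"

lemma cont_shift:
  fixes g :: "'a \<Rightarrow> complex"
  assumes "continuous_on UNIV g"
  shows "continuous_on UNIV (\<lambda>y. g (x - y))" "continuous_on UNIV (\<lambda>y. g (x + y))"
    "continuous_on UNIV (\<lambda>y. g (- y))"
  by (intro continuous_on_compose2[OF assms] continuous_intros; simp)+

lemma conv_integrand:
  fixes f g :: "'a \<Rightarrow> complex"
  shows "continuous_on UNIV f \<Longrightarrow> continuous_on UNIV g \<Longrightarrow> continuous_on UNIV (\<lambda>y. f y * g (x - y))"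
  by (rule continuous_on_mult[OF _ cont_shift(1)])

lemma norm_integral_le:
  fixes u :: "'a \<Rightarrow> 'b::{banach, second_countable_topology}"
  assumes "continuous_on UNIV u" "\<And>x. norm (u x) \<le> C"
  shows "norm (LINT x|\<mu>. u x) \<le> C"
proof -
  have "norm (LINT x|\<mu>. u x) \<le> (LINT x|\<mu>. norm (u x))" by (rule integral_norm_bound)
  also have "\<dots> \<le> (LINT x|\<mu>. C)"
    using assms by (intro integral_mono continuous_integrable continuous_intros) auto
  finally show ?thesis by (simp add: prob_space)
qed

lemma norm_conv_le:
  assumes "continuous_on UNIV f" "continuous_on UNIV g" "\<And>x. norm (f x) \<le> B" "\<And>x. norm (g x) \<le> C"
  shows "norm (conv f g x) \<le> B * C"
proof -
  have "norm (f y * g (x - y)) \<le> B * C" for y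
    unfolding norm_mult using assms(3)[of y] assms(4)[of "x - y"] norm_ge_zero[of "f y"]
    by (intro mult_mono) (auto intro: order_trans[OF norm_ge_zero])
  then show ?thesis unfolding conv_def by (intro norm_integral_le conv_integrand assms)
qed

lemma conv_diff_right:
  assumes "continuous_on UNIV f" "continuous_on UNIV g" "continuous_on UNIV h"
  shows "conv f (\<lambda>x. g x - h x) x = conv f g x - conv f h x"
  unfolding conv_def right_diff_distrib
  by (intro Bochner_Integration.integral_diff continuous_integrable conv_integrand assms)

lemma conv_add_right:
  assumes "continuous_on UNIV f" "continuous_on UNIV g" "continuous_on UNIV h"
  shows "conv f (\<lambda>x. g x + h x) x = conv f g x + conv f h x"
  unfolding conv_def distrib_left
  by (intro Bochner_Integration.integral_add continuous_integrable conv_integrand assms)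

lemma conv_scale_right: "conv f (\<lambda>x. c * g x) x = c * conv f g x"
  unfolding conv_def by (simp add: mult.left_commute)

lemma conv_shift_right: "conv f (\<lambda>x. g (a + x)) x = conv f g (a + x)"
  unfolding conv_def by (simp add: add_diff_eq)

lemma continuous_conv:
  assumes f: "continuous_on UNIV f" and g: "continuous_on UNIV g"
  shows "continuous_on UNIV (conv f g)"
  unfolding continuous_on_def
proof (intro ballI tendstoI)
  fix x and e :: real assume e: "e > 0"
  obtain B where B: "B > 0" "\<And>x. norm (f x) \<le> B" using continuous_bounded[OF f] by blast
  have "e / (2 * B) > 0" using e B(1) by simp
  then obtain V where V: "open V" "0 \<in> V" "\<And>x v. v \<in> V \<Longrightarrow> dist (g (x + v)) (g x) < e / (2 * B)"
    using uniform_continuity_group[OF compact_UNIV g] by blast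
  have "dist (conv f g y) (conv f g x) < e" if yV: "y \<in> (\<lambda>v. x + v) ` V" for y
  proof -
    obtain v where v: "v \<in> V" "y = x + v" using yV by auto
    have "conv f g y - conv f g x = conv f (\<lambda>z. g (v + z) - g z) x"
      using conv_diff_right[OF f cont_shift(2)[OF g, of v] g, of x] conv_shift_right[of f g v x]
      by (simp add: v(2) add.commute)
    also have "norm \<dots> \<le> B * (e / (2 * B))"
      using V(3)[OF v(1)] less_imp_le
      by (intro norm_conv_le B f continuous_intros cont_shift g) (auto simp: dist_norm add.commute)
    finally show ?thesis using e B(1) by (simp add: dist_norm)
  qed
  moreover have "x \<in> (\<lambda>v. x + v) ` V" using V(2) by force
  ultimately show "\<forall>\<^sub>F y in at x within UNIV. dist (conv f g y) (conv f g x) < e"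
    unfolding eventually_at_topological using open_plus_image[OF V(1), of x] by blast
qed

lemma conv_commute:
  assumes "continuous_on UNIV f" "continuous_on UNIV g"
  shows "conv f g = conv g f"
proof
  fix x
  have "conv f g x = (LINT y|\<mu>. f (x - y) * g (x - (x - y)))"
    unfolding conv_def using integral_reflect[OF conv_integrand[OF assms, of x], of x] by simp
  also have "\<dots> = conv g f x" unfolding conv_def by (simp add: mult.commute)
  finally show "conv f g x = conv g f x" .
qed

text \<open>Fubini; only the factor \<open>g (z - y)\<close> couples the two variables, and
  \<open>measurable_continuous_diff\<close> handles it.\<close>

lemma conv_assoc:
  assumes f: "continuous_on UNIV f" and g: "continuous_on UNIV g" and h: "continuous_on UNIV h"
  shows "conv (conv f g) h = conv f (conv g h)"
proof
  fix x
  interpret P: pair_prob_space \<mu> \<mu> ..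
  obtain F where F: "F > 0" "\<And>x. norm (f x) \<le> F" using continuous_bounded[OF f] by blast
  obtain G where G: "G > 0" "\<And>x. norm (g x) \<le> G" using continuous_bounded[OF g] by blast
  obtain H where H: "H > 0" "\<And>x. norm (h x) \<le> H" using continuous_bounded[OF h] by blast
  note [measurable] = continuous_measurable[OF f] continuous_measurable[OF cont_shift(1)[OF h, of x]]
    measurable_continuous_diff[OF g]
  have "(\<lambda>p. f (snd p) * (case p of (z, y) \<Rightarrow> g (z - y)) * h (x - fst p)) \<in> borel_measurable (\<mu> \<Otimes>\<^sub>M \<mu>)"
    by measurable
  then have m: "(\<lambda>(z, y). f y * g (z - y) * h (x - z)) \<in> borel_measurable (\<mu> \<Otimes>\<^sub>M \<mu>)"
    by (simp add: case_prod_beta)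
  have "norm (f y * g (z - y) * h (x - z)) \<le> F * G * H" for y z
    unfolding norm_mult using F G H by (intro mult_mono) auto
  then have int: "integrable (\<mu> \<Otimes>\<^sub>M \<mu>) (\<lambda>(z, y). f y * g (z - y) * h (x - z))"
    by (intro P.P.integrable_const_bound[of _ "F * G * H"] m) auto
  have "conv (conv f g) h x = (LINT z|\<mu>. LINT y|\<mu>. f y * g (z - y) * h (x - z))"
    unfolding conv_def by simp
  also have "\<dots> = (LINT y|\<mu>. LINT z|\<mu>. f y * g (z - y) * h (x - z))"
    using P.Fubini_integral[OF int] by simp
  also have "\<dots> = (LINT y|\<mu>. f y * (LINT z|\<mu>. g (z - y) * h (x - z)))"
    by (simp add: mult.assoc)
  also have "\<dots> = (LINT y|\<mu>. f y * conv g h (x - y))"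
  proof (intro Bochner_Integration.integral_cong refl arg_cong2[where f = "(*)"])
    fix y
    have "continuous_on UNIV (\<lambda>z. g (z - y) * h (x - z))"
      using cont_shift(2)[OF g, of "- y"] by (intro continuous_intros cont_shift h) simp
    from integral_plus[OF this, of y] show "(LINT z|\<mu>. g (z - y) * h (x - z)) = conv g h (x - y)"
      unfolding conv_def by (simp add: diff_diff_eq)
  qed
  finally show "conv (conv f g) h x = conv f (conv g h) x" unfolding conv_def .
qed

lemma adj_conv:
  assumes "continuous_on UNIV f" "continuous_on UNIV g"
  shows "adj (conv f g) = conv (adj f) (adj g)"
proof
  fix x
  have c: "continuous_on UNIV (\<lambda>y. cnj (f y * g (- x - y)))"
    by (intro continuous_intros assms cont_shift)
  have "adj (conv f g) x = (LINT y|\<mu>. cnj (f y * g (- x - y)))"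
    unfolding adj_def conv_def by (simp only: Bochner_Integration.integral_cnj)
  also have "\<dots> = (LINT y|\<mu>. cnj (f (- y) * g (- x - (- y))))"
    using integral_uminus[OF c] by simp
  also have "\<dots> = conv (adj f) (adj g) x" unfolding adj_def conv_def by (simp add: algebra_simps)
  finally show "adj (conv f g) x = conv (adj f) (adj g) x" .
qed

section \<open>Cauchy-Schwarz, and evaluation at 0 as a trace\<close>

lemma sqnorm_nonneg: "sqnorm f \<ge> 0"
  unfolding sqnorm_def by simp

lemma integral_mult_sq_le:
  assumes u: "continuous_on UNIV u" and v: "continuous_on UNIV v"
  shows "(norm (LINT x|\<mu>. u x * v x))\<^sup>2 \<le> sqnorm u * sqnorm v"
proof -
  define X where "X = norm (LINT x|\<mu>. u x * v x)"
  have int: "integrable \<mu> (\<lambda>x. (norm (u x))\<^sup>2)" "integrable \<mu> (\<lambda>x. (norm (v x))\<^sup>2)"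
    "integrable \<mu> (\<lambda>x. norm (u x * v x))"
    by (intro continuous_integrable continuous_intros u v)+
  have q: "2 * s * X \<le> s\<^sup>2 * sqnorm u + sqnorm v" if "s \<ge> 0" for s
  proof -
    have "X \<le> (LINT x|\<mu>. norm (u x * v x))" unfolding X_def by (rule integral_norm_bound)
    then have "2 * s * X \<le> 2 * s * (LINT x|\<mu>. norm (u x * v x))" using that by (intro mult_left_mono) auto
    also have "\<dots> = (LINT x|\<mu>. 2 * s * norm (u x * v x))" by simp
    also have "\<dots> \<le> (LINT x|\<mu>. s\<^sup>2 * (norm (u x))\<^sup>2 + (norm (v x))\<^sup>2)"
    proof (rule integral_mono)
      fix x
      have "0 \<le> (s * norm (u x) - norm (v x))\<^sup>2" by simp
      then show "2 * s * norm (u x * v x) \<le> s\<^sup>2 * (norm (u x))\<^sup>2 + (norm (v x))\<^sup>2"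
        by (simp add: norm_mult power2_eq_square algebra_simps)
    qed (use int in auto)
    also have "\<dots> = s\<^sup>2 * sqnorm u + sqnorm v" unfolding sqnorm_def using int by simp
    finally show ?thesis .
  qed
  have X0: "X \<ge> 0" unfolding X_def by simp
  show ?thesis
  proof (cases "sqnorm u = 0")
    case True
    have "X = 0"
    proof (rule ccontr)
      assume "X \<noteq> 0"
      \<comment> \<open>This weight makes the left side \<open>2 * (sqnorm v + 1)\<close>, which
        exceeds the right side.\<close>
      then have "2 * ((sqnorm v + 1) / X) * X \<le> sqnorm v"
        using q[of "(sqnorm v + 1) / X"] True X0 sqnorm_nonneg[of v] by simp
      then show False using \<open>X \<noteq> 0\<close> sqnorm_nonneg[of v] by simp
    qed
    then show ?thesis using True unfolding X_def by simp
  next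
    case False
    then have p: "sqnorm u > 0" using sqnorm_nonneg[of u] by simp
    \<comment> \<open>\<open>X / sqnorm u\<close> is the weight \<open>s\<close> for which
      \<open>q\<close> is sharpest.\<close>
    have "2 * (X / sqnorm u) * X \<le> (X / sqnorm u)\<^sup>2 * sqnorm u + sqnorm v"
      using q[of "X / sqnorm u"] X0 p by simp
    then have "X\<^sup>2 \<le> sqnorm u * sqnorm v"
      using p by (simp add: power2_eq_square field_simps)
    then show ?thesis unfolding X_def .
  qed
qed

lemma sqnorm_reflect: "continuous_on UNIV f \<Longrightarrow> sqnorm (\<lambda>y. f (x - y)) = sqnorm f"
  unfolding sqnorm_def by (rule integral_reflect) (intro continuous_intros)

text \<open>Convolution turns smallness in L2 into uniform smallness; the uniform convergence of the
  power iteration rests on this.\<close>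

lemma norm_conv_sq_le:
  assumes "continuous_on UNIV f" "continuous_on UNIV g"
  shows "(norm (conv f g x))\<^sup>2 \<le> sqnorm f * sqnorm g"
  using integral_mult_sq_le[OF assms(1) cont_shift(1)[OF assms(2), of x]] sqnorm_reflect[OF assms(2)]
  unfolding conv_def by simp

lemma norm_conv_self_le: "continuous_on UNIV f \<Longrightarrow> norm (conv f f x) \<le> sqnorm f"
  using norm_conv_sq_le[of f f x] sqnorm_nonneg[of f]
  by (simp add: power2_eq_square[symmetric] power2_le_iff_abs_le)

text \<open>Since \<open>f (- y)\<close> is the conjugate of \<open>f y\<close>, evaluation at 0
  acts on self-convolutions like a trace.\<close>

lemma conv_self_0:
  assumes "adj f = f" shows "conv f f 0 = of_real (sqnorm f)"
proof -
  have "f (- y) = cnj (f y)" for y using fun_cong[OF assms, of "- y"] by (simp add: adj_def)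
  then show ?thesis unfolding conv_def sqnorm_def by (simp add: complex_norm_square[symmetric] flip: integral_complex_of_real)
qed

lemma sqnorm_pos:
  assumes f: "continuous_on UNIV f" and "f x \<noteq> 0" shows "sqnorm f > 0"
proof -
  have "sqnorm f \<noteq> 0"
  proof
    assume "sqnorm f = 0"
    moreover have "integrable \<mu> (\<lambda>x. (norm (f x))\<^sup>2)"
      by (intro continuous_integrable continuous_intros f)
    ultimately have "AE x in \<mu>. (norm (f x))\<^sup>2 = 0"
      unfolding sqnorm_def using integral_nonneg_eq_0_iff_AE[of \<mu> "\<lambda>x. (norm (f x))\<^sup>2"] by simp
    then have "AE x in \<mu>. x \<notin> f -` (- {0})" by auto
    moreover have o: "open (f -` (- {0}))" using f by (rule open_vimage[rotated]) auto
    ultimately have "measure \<mu> (f -` (- {0})) = 0"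
      by (subst prob_eq_0) auto
    moreover have "x \<in> f -` (- {0})" using assms(2) by simp
    ultimately show False using measure_open_pos[OF o] by fastforce
  qed
  then show ?thesis using sqnorm_nonneg[of f] by simp
qed

end

section \<open>Eigenprojections of convolution operators\<close>

text \<open>By log-convexity the ratios of neighbours increase, and submultiplicativity bounds them
  by \<open>a 0\<close>; \<open>r\<close> is their limit. Then \<open>a (m + n + 1) / a m\<close>
  tends to \<open>r ^ (n + 1)\<close> as \<open>m\<close> grows, while staying at most
  \<open>a n\<close>. The exponent is shifted because \<open>a n\<close> will belong to the
  convolution power \<open>n + 1\<close>.\<close>

lemma log_convex_submultiplicative:
  fixes a :: "nat \<Rightarrow> real"
  assumes pos: "\<And>n. a n > 0" and lc: "\<And>n. (a (Suc n))\<^sup>2 \<le> a n * a (Suc (Suc n))"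
    and sm: "\<And>n m. a (Suc (n + m)) \<le> a n * a m"
  obtains r where "r > 0" "\<And>n. r ^ Suc n \<le> a n" "\<And>n. a (Suc n) \<le> r * a n"
proof -
  define q where "q = (\<lambda>n. a (Suc n) / a n)"
  have "incseq q"
  proof (rule incseq_SucI)
    fix n show "q n \<le> q (Suc n)"
      using lc[of n] pos[of n] pos[of "Suc n"] by (simp add: q_def field_simps power2_eq_square)
  qed
  moreover have qb: "q n \<le> a 0" for n
    using sm[of n 0] pos[of n] by (simp add: q_def field_simps)
  ultimately obtain r where r: "q \<longlonglongrightarrow> r" "\<And>n. q n \<le> r"
    using incseq_convergent by blast
  have "0 < q 0" using pos by (simp add: q_def)
  then have r0: "r > 0" using r(2)[of 0] by linarith
  have pw: "(\<lambda>m. a (m + n) / a m) \<longlonglongrightarrow> r ^ n" for n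
  proof (induction n)
    case 0
    have "a m / a m = 1" for m using pos[of m] by simp
    then show ?case by simp
  next
    case (Suc n)
    have "(\<lambda>m. q (m + n)) \<longlonglongrightarrow> r" using r(1) by (rule LIMSEQ_ignore_initial_segment)
    from tendsto_mult[OF this Suc.IH] show ?case
      using pos by (simp add: q_def less_imp_neq[symmetric])
  qed
  show thesis
  proof
    show "r > 0" by (rule r0)
    fix n
    show "r ^ Suc n \<le> a n"
    proof (rule LIMSEQ_le_const2[OF pw], intro exI allI impI)
      fix m :: nat
      show "a (m + Suc n) / a m \<le> a n" using sm[of m n] pos[of m] by (simp add: field_simps)
    qed
    show "a (Suc n) \<le> r * a n" using r(2)[of n] pos[of n] by (simp add: q_def field_simps)
  qed
qed

context compact_haar
begin

lemma tendsto_conv_left: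
  assumes u: "\<And>n. continuous_on UNIV (u n)" and P: "continuous_on UNIV P" and w: "continuous_on UNIV w"
    and lim: "uniform_limit UNIV u P sequentially"
  shows "(\<lambda>n. conv (u n) w x) \<longlonglongrightarrow> conv P w x"
proof (rule tendstoI)
  fix e :: real assume e: "e > 0"
  obtain B where B: "B > 0" "\<And>x. norm (w x) \<le> B" using continuous_bounded[OF w] by blast
  have "e / (2 * B) > 0" using e B(1) by simp
  from uniform_limitD[OF lim this]
  show "\<forall>\<^sub>F n in sequentially. dist (conv (u n) w x) (conv P w x) < e"
  proof eventually_elim
    case (elim n)
    have "conv (u n) w x - conv P w x = conv w (\<lambda>y. u n y - P y) x"
      by (simp add: conv_diff_right[OF w u P] conv_commute[OF u w] conv_commute[OF P w])
    also have "norm \<dots> \<le> B * (e / (2 * B))"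
      using elim by (intro norm_conv_le w B continuous_intros u P) (auto simp: dist_norm less_imp_le)
    finally show ?case using e B(1) by (simp add: dist_norm)
  qed
qed

lemma tendsto_conv_right:
  assumes u: "\<And>n. continuous_on UNIV (u n)" and P: "continuous_on UNIV P" and w: "continuous_on UNIV w"
    and lim: "uniform_limit UNIV u P sequentially"
  shows "(\<lambda>n. conv w (u n) x) \<longlonglongrightarrow> conv w P x"
  using tendsto_conv_left[OF u P w lim, of x] by (simp add: conv_commute[OF u w] conv_commute[OF P w])

text \<open>Power iteration: with \<open>F = f * f\<close>, the convolution powers \<open>F\<^sup>n / r\<^sup>n\<close> converge to the projection onto
  the eigenspace of the largest eigenvalue \<open>r\<close> of \<open>F\<close>. It is nonzero because
  \<open>F\<^sup>n(0) = \<parallel>f\<^sup>n\<parallel>\<^sup>2\<close> is submultiplicative.\<close>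

theorem convolution_spectral_projection:
  assumes f: "continuous_on UNIV f" and adj: "adj f = f" and nz: "f x0 \<noteq> 0"
  obtains P r where "continuous_on UNIV P" "adj P = P" "P 0 \<noteq> 0" "conv P P = P"
    "\<forall>x. conv P (conv f f) x = of_real r * P x"
    "\<forall>u c. continuous_on UNIV u \<longrightarrow> (\<forall>x. conv u f x = c * f x) \<longrightarrow> (\<forall>x. conv u P x = c * P x)"
proof -
  \<comment> \<open>\<open>h n\<close> is the convolution power of exponent \<open>n + 1\<close>, as
    there is no continuous unit in general; the powers of \<open>conv f f\<close> are the
    \<open>h (Suc (n + n))\<close>.\<close>
  define h where "h = rec_nat f (\<lambda>_. conv f)"
  have h0: "h 0 = f" and hS: "\<And>n. h (Suc n) = conv f (h n)" by (simp_all add: h_def)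
  have hc: "continuous_on UNIV (h n)" for n
    by (induction n) (auto simp: h0 hS f continuous_conv)
  have ha: "adj (h n) = h n" for n
    by (induction n) (auto simp: h0 hS adj adj_conv f hc)
  have hh: "conv (h n) (h m) = h (Suc (n + m))" for n m
    by (induction n) (auto simp: h0 hS conv_assoc f hc)
  define a where "a = (\<lambda>n. sqnorm (h n))"
  have h_at_0: "h (Suc (n + n)) 0 = of_real (a n)" for n
    using conv_self_0[OF ha] by (simp add: hh a_def)
  have h_le: "norm (h (Suc (n + n)) x) \<le> a n" for n x
    using norm_conv_self_le[OF hc[of n]] by (simp add: hh a_def)
  \<comment> \<open>Cauchy-Schwarz for the factors \<open>h n\<close> and \<open>h (n + 2)\<close>,
    whose convolution is the self-convolution of \<open>h (n + 1)\<close>.\<close>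
  have lc: "(a (Suc n))\<^sup>2 \<le> a n * a (Suc (Suc n))" for n
  proof -
    have "(norm (conv (h n) (h (Suc (Suc n))) 0))\<^sup>2 \<le> a n * a (Suc (Suc n))"
      unfolding a_def by (rule norm_conv_sq_le[OF hc hc])
    moreover have "conv (h n) (h (Suc (Suc n))) 0 = of_real (a (Suc n))"
      using h_at_0[of "Suc n"] by (simp add: hh)
    ultimately show ?thesis by simp
  qed
  have sm: "a (Suc (n + m)) \<le> a n * a m" for n m
  proof -
    have "norm (conv (h (Suc (n + n))) (h (Suc (m + m))) 0) \<le> a n * a m"
      by (rule norm_conv_le[OF hc hc h_le h_le])
    moreover have "conv (h (Suc (n + n))) (h (Suc (m + m))) 0 = of_real (a (Suc (n + m)))"
      using h_at_0[of "Suc (n + m)"] by (simp add: hh algebra_simps)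
    ultimately show ?thesis by simp
  qed
  have a0: "a 0 > 0" unfolding a_def h0 by (rule sqnorm_pos[OF f nz])
  then have "h 1 0 \<noteq> 0" using h_at_0[of 0] by simp
  then have a1: "a (Suc 0) > 0" unfolding a_def using sqnorm_pos[OF hc, of 1 0] by simp
  have pos: "a n > 0" for n
  proof (induction n rule: nat_less_induct)
    case (1 n)
    show ?case
    proof (cases "n = 0 \<or> n = 1")
      case True then show ?thesis using a0 a1 by auto
    next
      case False
      then obtain m where m: "n = Suc (Suc m)" by (metis One_nat_def not0_implies_Suc)
      have "a (Suc m) > 0" "a m > 0" using 1 m by auto
      then have "0 < a m * a (Suc (Suc m))" using lc[of m] by (smt (verit) zero_less_power)
      then show ?thesis using \<open>a m > 0\<close> m by (simp add: zero_less_mult_iff)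
    qed
  qed
  obtain r where r: "r > 0" "\<And>n. r ^ Suc n \<le> a n" "\<And>n. a (Suc n) \<le> r * a n"
    using log_convex_submultiplicative[of a, OF pos lc sm] by blast
  \<comment> \<open>After this normalisation the sequence decreases but stays at least 1; the lower
    bound keeps the limit projection nonzero at 0.\<close>
  define b where "b = (\<lambda>n. a n / r ^ Suc n)"
  have b1: "b n \<ge> 1" for n using r(1) r(2)[of n] by (simp add: b_def field_simps)
  have db: "decseq b"
  proof (rule decseq_SucI)
    fix n show "b (Suc n) \<le> b n" using r(1) r(3)[of n] by (simp add: b_def field_simps)
  qed
  then obtain \<beta> where \<beta>: "b \<longlonglongrightarrow> \<beta>" using decseq_convergent[OF db] b1 by blast
  define g where "g = (\<lambda>n x. h (Suc (n + n)) x / of_real (r ^ Suc n))"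
  have gc: "continuous_on UNIV (g n)" for n
    unfolding g_def using r(1) by (intro continuous_intros hc) auto
  have ga: "adj (g n) = g n" for n
    using ha[of "Suc (n + n)"] by (auto simp: adj_def g_def fun_eq_iff)
  have gg: "conv (g n) (g m) = g (Suc (n + m))" for n m
  proof
    fix x
    have e: "g n = (\<lambda>x. (1 / of_real (r ^ Suc n)) * h (Suc (n + n)) x)" for n by (auto simp: g_def)
    have "conv (g n) (g m) x = (1 / of_real (r ^ Suc m)) * conv (g n) (h (Suc (m + m))) x"
      unfolding e[of m] by (rule conv_scale_right)
    also have "conv (g n) (h (Suc (m + m))) x = (1 / of_real (r ^ Suc n)) * conv (h (Suc (m + m))) (h (Suc (n + n))) x"
      unfolding conv_commute[OF gc hc] unfolding e[of n] by (rule conv_scale_right)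
    finally show "conv (g n) (g m) x = g (Suc (n + m)) x"
      by (simp add: hh g_def power_add algebra_simps)
  qed
  have g_at_0: "g n 0 = of_real (b n)" for n by (simp add: g_def h_at_0 b_def)
  \<comment> \<open>The L2 distances depend on \<open>b\<close> alone, so convergence of
    \<open>b\<close> already makes \<open>g\<close> Cauchy in L2.\<close>
  have sq: "sqnorm (\<lambda>x. g n x - g m x) = b (Suc (n + n)) - 2 * b (Suc (n + m)) + b (Suc (m + m))" for n m
  proof -
    let ?u = "\<lambda>x. g n x - g m x"
    have uc: "continuous_on UNIV ?u" by (intro continuous_intros gc)
    have "adj ?u = ?u" using ga[of n] ga[of m] by (auto simp: adj_def fun_eq_iff)
    then have "of_real (sqnorm ?u) = conv ?u ?u 0" by (simp add: conv_self_0)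
    also have "\<dots> = conv ?u (g n) 0 - conv ?u (g m) 0" by (rule conv_diff_right[OF uc gc gc])
    also have "\<dots> = (conv (g n) (g n) 0 - conv (g n) (g m) 0) - (conv (g m) (g n) 0 - conv (g m) (g m) 0)"
      unfolding conv_commute[OF uc gc] by (simp add: conv_diff_right[OF gc gc gc])
    also have "\<dots> = of_real (b (Suc (n + n)) - 2 * b (Suc (n + m)) + b (Suc (m + m)))"
      by (simp add: gg g_at_0 add.commute)
    finally show ?thesis by (simp only: of_real_eq_iff)
  qed
  have "uniformly_Cauchy_on UNIV (\<lambda>n. g (Suc n))"
  proof (rule uniformly_Cauchy_onI)
    fix e :: real assume e: "e > 0"
    define A where "A = sqnorm (g 0)"
    have A: "A \<ge> 0" unfolding A_def by (rule sqnorm_nonneg)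
    \<comment> \<open>The three values of \<open>b\<close> in \<open>sq\<close> have weights 1, 2,
      1, so errors below \<open>d / 4\<close> add up to less than \<open>d\<close>; the
      \<open>+ 1\<close> yields \<open>A * d < e\<^sup>2\<close>.\<close>
    define d where "d = e\<^sup>2 / (A + 1)"
    have "d / 4 > 0" using e A by (simp add: d_def)
    from LIMSEQ_D[OF \<beta> this] obtain N where N: "\<And>n. n \<ge> N \<Longrightarrow> \<bar>b n - \<beta>\<bar> < d / 4" by auto
    show "\<exists>M. \<forall>x\<in>UNIV. \<forall>m\<ge>M. \<forall>n\<ge>M. dist (g (Suc m) x) (g (Suc n) x) < e"
    proof (intro exI ballI allI impI)
      fix x m n assume mn: "m \<ge> N" "n \<ge> N"
      have s: "sqnorm (\<lambda>x. g m x - g n x) < d"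
      proof -
        have "\<bar>b (Suc (m + m)) - \<beta>\<bar> < d / 4" "\<bar>b (Suc (m + n)) - \<beta>\<bar> < d / 4" "\<bar>b (Suc (n + n)) - \<beta>\<bar> < d / 4"
          by (rule N, use mn in simp)+
        then show ?thesis unfolding sq by linarith
      qed
      \<comment> \<open>One extra factor \<open>g 0\<close> upgrades the L2 estimate to a uniform
        one, hence the sequence indexed by \<open>Suc n\<close>.\<close>
      have "g (Suc m) x - g (Suc n) x = conv (g 0) (\<lambda>x. g m x - g n x) x"
        by (simp add: conv_diff_right[OF gc gc gc] gg)
      then have "(norm (g (Suc m) x - g (Suc n) x))\<^sup>2 \<le> A * sqnorm (\<lambda>x. g m x - g n x)"
        unfolding A_def using norm_conv_sq_le[OF gc[of 0] continuous_on_diff[OF gc[of m] gc[of n]], of x] by simp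
      also have "\<dots> \<le> A * d" using s A by (intro mult_left_mono) auto
      also have "\<dots> < e\<^sup>2" using A e by (simp add: d_def field_simps)
      finally show "dist (g (Suc m) x) (g (Suc n) x) < e"
        using e by (simp add: dist_norm power2_less_imp_less)
    qed
  qed
  then obtain P where lim: "uniform_limit UNIV (\<lambda>n. g (Suc n)) P sequentially"
    using Cauchy_uniformly_convergent uniformly_convergent_on_def by blast
  have Pc: "continuous_on UNIV P"
    using lim gc by (intro uniform_limit_theorem[OF _ lim]) auto
  have pt: "(\<lambda>n. g (Suc n) x) \<longlonglongrightarrow> P x" for x using tendsto_uniform_limitI[OF lim] by simp
  have pt': "(\<lambda>n. g (Suc (n + m)) x) \<longlonglongrightarrow> P x" for x m
    using LIMSEQ_ignore_initial_segment[OF pt[of x], of m] by simp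
  have Pa: "adj P = P"
  proof
    fix x
    have "(\<lambda>n. cnj (g (Suc n) (- x))) \<longlonglongrightarrow> cnj (P (- x))" by (intro tendsto_cnj pt)
    moreover have "cnj (g (Suc n) (- x)) = g (Suc n) x" for n
      using fun_cong[OF ga[of "Suc n"], of x] by (simp add: adj_def)
    ultimately show "adj P x = P x" unfolding adj_def using pt[of x] by (simp add: LIMSEQ_unique)
  qed
  have Pg: "conv P (g m) = P" for m
  proof
    fix x
    have "(\<lambda>n. g (Suc (n + Suc m)) x) \<longlonglongrightarrow> conv P (g m) x"
      using tendsto_conv_left[where u = "\<lambda>n. g (Suc n)", OF gc Pc gc[of m] lim, of x] by (simp add: gg)
    then show "conv P (g m) x = P x" using pt'[of "Suc m" x] by (rule LIMSEQ_unique)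
  qed
  have PP: "conv P P = P"
  proof
    fix x
    have "(\<lambda>n. P x) \<longlonglongrightarrow> conv P P x" using tendsto_conv_right[where u = "\<lambda>n. g (Suc n)", OF gc Pc Pc lim, of x] by (simp add: Pg)
    then show "conv P P x = P x" by (simp add: LIMSEQ_const_iff)
  qed
  have "(\<lambda>n. of_real (b (Suc n))) \<longlonglongrightarrow> P 0" using pt[of 0] by (simp add: g_at_0)
  moreover have "(\<lambda>n. complex_of_real (b (Suc n))) \<longlonglongrightarrow> of_real \<beta>"
    using \<beta> by (intro tendsto_of_real LIMSEQ_Suc)
  ultimately have "P 0 = of_real \<beta>" by (rule LIMSEQ_unique)
  moreover have "\<beta> \<ge> 1" using \<beta> b1 by (intro LIMSEQ_le_const) auto
  ultimately have P0: "P 0 \<noteq> 0" by auto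
  have F: "conv f f = (\<lambda>x. of_real r * g 0 x)"
    using r(1) hS[of 0] by (auto simp: g_def h0)
  have PF: "conv P (conv f f) x = of_real r * P x" for x
    unfolding F conv_scale_right Pg ..
  \<comment> \<open>Applied with \<open>u = 1\<close>, \<open>c = 0\<close> this keeps the mean
    zero; with \<open>c = 1\<close> and \<open>u\<close> an idempotent fixing \<open>f\<close> it
    keeps the projection inside the range of \<open>u\<close>.\<close>
  have eig: "conv u P x = c * P x" if u: "continuous_on UNIV u" and uf: "\<And>x. conv u f x = c * f x" for u c x
  proof -
    have "conv u (h n) y = c * h n y" for n y
    proof (cases n)
      case (Suc m)
      have "conv u (h n) = conv (conv u f) (h m)" unfolding Suc hS by (rule conv_assoc[symmetric, OF u f hc])
      also have "\<dots> = conv (h m) (\<lambda>x. c * f x)"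
        unfolding conv_commute[OF continuous_conv[OF u f] hc] using ext[of "conv u f", OF uf] by simp
      finally show ?thesis using conv_scale_right[of "h m" c f y] by (simp add: Suc hS conv_commute[OF hc f])
    qed (simp add: h0 uf)
    then have "conv u (g n) y = c * g n y" for n y
      using conv_scale_right[of u "1 / of_real (r ^ Suc n)" "h (Suc (n + n))" y] by (simp add: g_def)
    then have "(\<lambda>n. c * g (Suc n) x) \<longlonglongrightarrow> conv u P x"
      using tendsto_conv_right[where u = "\<lambda>n. g (Suc n)", OF gc Pc u lim, of x] by simp
    moreover have "(\<lambda>n. c * g (Suc n) x) \<longlonglongrightarrow> c * P x" by (intro tendsto_intros pt)
    ultimately show ?thesis by (rule LIMSEQ_unique)
  qed
  show thesis
  proof (rule that[OF Pc Pa P0 PP])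
    show "\<forall>x. conv P (conv f f) x = of_real r * P x" using PF by simp
    show "\<forall>u c. continuous_on UNIV u \<longrightarrow> (\<forall>x. conv u f x = c * f x) \<longrightarrow> (\<forall>x. conv u P x = c * P x)"
      by (intro allI impI, rule eig, assumption, erule spec)
  qed
qed

end

section \<open>Existence of a nontrivial character\<close>

context compact_haar
begin

text \<open>The input of the power iteration: a Urysohn function separating 0 from \<open>z\<close>,
  with its mean subtracted to remove the trivial character.\<close>

lemma nonconstant_hermitian_function:
  assumes "(z::'a) \<noteq> 0"
  obtains f x where "continuous_on UNIV f" "adj f = f" "f x \<noteq> 0" "\<forall>x. conv (\<lambda>_. 1) f x = 0"
proof -
  have "Hausdorff_space (euclidean :: 'a topology)"
    unfolding Hausdorff_space_def disjnt_def by (auto dest!: hausdorff)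
  then have "normal_space (euclidean :: 'a topology)"
    using compact_UNIV by (intro compact_Hausdorff_or_regular_imp_normal_space)
      (auto simp: compact_space_def)
  then obtain w :: "'a \<Rightarrow> real" where w: "continuous_map euclidean euclidean w"
    "w ` {0} \<subseteq> {0}" "w ` {z} \<subseteq> {1}"
    by (rule Urysohn_lemma_alt[of euclidean "{0}" "{z}" 0 1]) (use assms in \<open>simp_all add: disjnt_def\<close>)
  have wc: "continuous_on UNIV w" using w(1) by simp
  define q where "q x = complex_of_real (w x - (LINT x|\<mu>. w x))" for x
  have qc: "continuous_on UNIV q" unfolding q_def by (intro continuous_intros wc)
  have q0: "(LINT x|\<mu>. q x) = 0"
    unfolding q_def using continuous_integrable[OF wc] by (simp add: prob_space)
  have "q z - q 0 = 1" using w by (simp add: q_def)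
  have "\<exists>x. q x \<noteq> 0"
  proof (rule ccontr)
    assume "\<nexists>x. q x \<noteq> 0"
    then have "q z = 0" "q 0 = 0" by blast+
    with \<open>q z - q 0 = 1\<close> show False by simp
  qed
  then obtain x where x: "q x \<noteq> 0" ..
  have cq: "continuous_on UNIV (\<lambda>x. cnj (q (- x)))" by (intro continuous_intros cont_shift qc)
  have cq0: "(LINT x|\<mu>. cnj (q (- x))) = 0"
    using integral_uminus[of "\<lambda>x. cnj (q x)"] qc q0 by (simp add: continuous_on_cnj)
  note result = that
  \<comment> \<open>The combination is hermitian for every \<open>d\<close>; those for
    \<open>d = 1\<close> and \<open>d = \<i>\<close> cannot both vanish at \<open>x\<close>, where
    \<open>q\<close> does not.\<close>
  have fin: thesis if nz: "d * q x + cnj d * cnj (q (- x)) \<noteq> 0" for d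
  proof -
    let ?f = "\<lambda>x. d * q x + cnj d * cnj (q (- x))"
    have fc: "continuous_on UNIV ?f" by (intro continuous_intros qc cq)
    have "(LINT x|\<mu>. ?f x) = 0"
      using continuous_integrable[OF qc] continuous_integrable[OF cq] q0 cq0 by simp
    then have "conv (\<lambda>_. 1) ?f x = 0" for x
      unfolding conv_def using integral_reflect[OF fc, of x] by simp
    then have f1: "\<forall>x. conv (\<lambda>_. 1) ?f x = 0" ..
    have "adj ?f = ?f" by (auto simp: adj_def add.commute)
    then show thesis using fc nz f1 by (intro result[of ?f x])
  qed
  show thesis
  proof (cases "q x + cnj (q (- x)) = 0")
    case False then show thesis using fin[of 1] by simp
  next
    case True
    then have "cnj (q (- x)) = - q x" by (simp add: eq_neg_iff_add_eq_0 add.commute)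
    then show thesis using fin[of \<i>] x by simp
  qed
qed

text \<open>A minimal such idempotent spans its own range, so translations multiply it by scalars: it is
  a multiple of a character. The last condition excludes the trivial one.\<close>

definition idem :: "('a \<Rightarrow> complex) \<Rightarrow> bool" where
  "idem P \<longleftrightarrow> continuous_on UNIV P \<and> adj P = P \<and> conv P P = P \<and> P \<noteq> (\<lambda>_. 0) \<and>
     (\<forall>x. conv (\<lambda>_. 1) P x = 0)"

lemma conv_zero_left: "conv (\<lambda>_. 0) f x = 0"
  by (simp add: conv_def)

text \<open>\<open>sqnorm P\<close> is the trace of convolution by \<open>P\<close>, that is, the
  dimension of its range. The lower bound 1, from the sup norm estimate for \<open>conv P P\<close>
  at 0, is what drives the descent to a minimal idempotent.\<close>

lemma idem_sqnorm:
  assumes "idem P" shows "P 0 = of_real (sqnorm P)" "norm (P x) \<le> sqnorm P" "sqnorm P \<ge> 1"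
proof -
  have P: "continuous_on UNIV P" "adj P = P" "conv P P = P" using assms by (auto simp: idem_def)
  show P0: "P 0 = of_real (sqnorm P)" using conv_self_0[OF P(2)] by (simp add: P(3))
  show le: "norm (P x) \<le> sqnorm P" for x using norm_conv_self_le[OF P(1), of x] by (simp add: P(3))
  obtain y where y: "P y \<noteq> 0" using assms by (auto simp: idem_def)
  have pos: "sqnorm P > 0" by (rule sqnorm_pos[OF P(1) y])
  have "norm (conv P P 0) \<le> sqnorm P * sqnorm P" by (rule norm_conv_le[OF P(1) P(1) le le])
  then have "sqnorm P \<le> sqnorm P * sqnorm P" using P0 pos by (simp add: P(3))
  then show "sqnorm P \<ge> 1" using pos by simp
qed

lemma idem_from_hermitian:
  assumes f: "continuous_on UNIV f" "adj f = f" "f x \<noteq> 0" "\<And>x. conv (\<lambda>_. 1) f x = 0"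
  obtains P r where "idem P" "\<forall>x. conv P (conv f f) x = of_real r * P x"
    "\<forall>u c. continuous_on UNIV u \<longrightarrow> (\<forall>x. conv u f x = c * f x) \<longrightarrow> (\<forall>x. conv u P x = c * P x)"
proof -
  obtain P r where P: "continuous_on UNIV P" "adj P = P" "P 0 \<noteq> 0" "conv P P = P"
    and r: "\<forall>x. conv P (conv f f) x = of_real r * P x"
    and e: "\<forall>u c. continuous_on UNIV u \<longrightarrow> (\<forall>x. conv u f x = c * f x) \<longrightarrow> (\<forall>x. conv u P x = c * P x)"
    by (rule convolution_spectral_projection[OF f(1-3)])
  have "conv (\<lambda>_. 1) P x = 0" for x using e[rule_format, of "\<lambda>_. 1" 0 x] f(4) by simp
  then have "idem P" using P by (auto simp: idem_def)
  then show thesis using r e by (rule that)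
qed

text \<open>The projection \<open>Q\<close> obtained from \<open>f\<close> lies below
  \<open>P\<close>. If they differed, \<open>P - Q\<close> would be an idempotent too, so
  \<open>sqnorm Q\<close> would be smaller by at least 1, and so would its floor. Hence
  \<open>Q = P\<close>, and convolution by \<open>P\<close> both fixes \<open>conv f f\<close> and
  gives \<open>r * P\<close>.\<close>

lemma minimal_idem_square:
  assumes P: "idem P" and min: "\<And>Q. idem Q \<Longrightarrow> nat \<lfloor>sqnorm P\<rfloor> \<le> nat \<lfloor>sqnorm Q\<rfloor>"
    and f: "continuous_on UNIV f" "adj f = f" "conv P f = f"
  obtains r where "conv f f = (\<lambda>x. r * P x)"
proof (cases "f = (\<lambda>_. 0)")
  case True
  then have "conv f f = (\<lambda>x. 0 * P x)" using conv_zero_left by auto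
  then show thesis by (rule that)
next
  case False
  then obtain y where y: "f y \<noteq> 0" by auto
  have Pc: "continuous_on UNIV P" and Pa: "adj P = P" and PP: "conv P P = P"
    and P1: "\<And>x. conv (\<lambda>_. 1) P x = 0" using P by (auto simp: idem_def)
  have one: "continuous_on UNIV (\<lambda>_. 1 :: complex)" by simp
  have "conv (\<lambda>_. 1) f x = 0" for x
  proof -
    have "conv (\<lambda>_. 1) f = conv (conv (\<lambda>_. 1) P) f"
      using conv_assoc[OF one Pc f(1)] f(3) by simp
    also have "conv (\<lambda>_. 1) P = (\<lambda>_. 0)" using P1 by auto
    finally show ?thesis by (simp add: conv_zero_left)
  qed
  from idem_from_hermitian[OF f(1,2) y this] obtain Q r where Q: "idem Q"
    and r: "\<forall>x. conv Q (conv f f) x = of_real r * Q x"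
    and e: "\<forall>u c. continuous_on UNIV u \<longrightarrow> (\<forall>x. conv u f x = c * f x) \<longrightarrow> (\<forall>x. conv u Q x = c * Q x)" .
  have Qc: "continuous_on UNIV Q" and Qa: "adj Q = Q" and QQ: "conv Q Q = Q"
    and Q1: "\<And>x. conv (\<lambda>_. 1) Q x = 0" using Q by (auto simp: idem_def)
  have PQ: "conv P Q = Q" using e[rule_format, OF Pc, of 1] f(3) by (simp add: fun_eq_iff)
  have "Q = P"
  proof (rule ccontr)
    assume ne: "Q \<noteq> P"
    let ?R = "\<lambda>x. P x - Q x"
    have Rc: "continuous_on UNIV ?R" by (intro continuous_intros Pc Qc)
    have Ra: "adj ?R = ?R" using Pa Qa by (auto simp: adj_def fun_eq_iff)
    have "conv ?R ?R x = ?R x" for x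
    proof -
      have "conv ?R ?R x = conv ?R P x - conv ?R Q x" by (rule conv_diff_right[OF Rc Pc Qc])
      also have "\<dots> = conv P ?R x - conv Q ?R x" by (simp add: conv_commute[OF Rc Pc] conv_commute[OF Rc Qc])
      also have "\<dots> = (P x - Q x) - (conv P Q x - Q x)"
        unfolding conv_diff_right[OF Pc Pc Qc] conv_diff_right[OF Qc Pc Qc] conv_commute[OF Qc Pc] PP QQ PQ ..
      finally show ?thesis by (simp add: PQ)
    qed
    moreover have "conv (\<lambda>_. 1) ?R x = 0" for x unfolding conv_diff_right[OF one Pc Qc] by (simp add: P1 Q1)
    moreover have "?R \<noteq> (\<lambda>_. 0)"
    proof
      assume "?R = (\<lambda>_. 0)"
      then have "Q = P" by (simp add: fun_eq_iff)
      with ne show False ..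
    qed
    ultimately have R: "idem ?R" using Rc Ra unfolding idem_def by (auto simp: fun_eq_iff)
    have "complex_of_real (sqnorm ?R) = of_real (sqnorm P - sqnorm Q)"
      using idem_sqnorm(1)[OF P] idem_sqnorm(1)[OF Q] idem_sqnorm(1)[OF R] by simp
    then have "sqnorm ?R = sqnorm P - sqnorm Q" by (simp only: of_real_eq_iff)
    then have "sqnorm Q + 1 \<le> sqnorm P" using idem_sqnorm(3)[OF R] by linarith
    then have "\<lfloor>sqnorm Q\<rfloor> + 1 \<le> \<lfloor>sqnorm P\<rfloor>" by linarith
    then show False using min[OF Q] idem_sqnorm(3)[OF Q] by linarith
  qed
  have "conv f f = conv P (conv f f)"
    using conv_assoc[OF Pc f(1) f(1)] f(3) by simp
  then have "conv f f = (\<lambda>x. of_real r * P x)" using r \<open>Q = P\<close> by (auto simp: fun_eq_iff)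
  then show thesis by (rule that)
qed

text \<open>Polarisation: the self-convolution of \<open>f + P\<close> is
  \<open>conv f f + 2 f + P\<close>; both it and \<open>conv f f\<close> are multiples of
  \<open>P\<close>, so \<open>f\<close> is one too.\<close>

lemma minimal_idem_hermitian:
  assumes P: "idem P" and min: "\<And>Q. idem Q \<Longrightarrow> nat \<lfloor>sqnorm P\<rfloor> \<le> nat \<lfloor>sqnorm Q\<rfloor>"
    and f: "continuous_on UNIV f" "adj f = f" "conv P f = f"
  obtains r where "f = (\<lambda>x. r * P x)"
proof -
  have Pc: "continuous_on UNIV P" and Pa: "adj P = P" and PP: "conv P P = P"
    using P by (auto simp: idem_def)
  obtain r where r: "conv f f = (\<lambda>x. r * P x)" by (rule minimal_idem_square[OF P min f])
  let ?g = "\<lambda>x. f x + P x"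
  have gc: "continuous_on UNIV ?g" by (intro continuous_intros f Pc)
  have ga: "adj ?g = ?g" using Pa f(2) by (auto simp: adj_def fun_eq_iff)
  have Pg: "conv P ?g = ?g" using conv_add_right[OF Pc f(1) Pc] by (simp add: fun_eq_iff f(3) PP)
  obtain s where s: "conv ?g ?g = (\<lambda>x. s * P x)" by (rule minimal_idem_square[OF P min gc ga Pg])
  have "f x = ((s - r - 1) / 2) * P x" for x
  proof -
    have "s * P x = conv ?g ?g x" by (simp add: s)
    also have "\<dots> = conv ?g f x + conv ?g P x" by (rule conv_add_right[OF gc f(1) Pc])
    also have "\<dots> = (conv f f x + conv f P x) + (conv P f x + conv P P x)"
      unfolding conv_commute[OF gc f(1)] conv_commute[OF gc Pc]
      by (simp add: conv_add_right[OF f(1) f(1) Pc] conv_add_right[OF Pc f(1) Pc])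
    also have "\<dots> = r * P x + 2 * f x + P x"
      unfolding conv_commute[OF f(1) Pc] f(3) PP r by simp
    finally show ?thesis by (simp add: field_simps)
  qed
  then have "f = (\<lambda>x. ((s - r - 1) / 2) * P x)" by (rule ext)
  then show thesis by (rule that)
qed

theorem nontrivial_character_exists:
  assumes "(z::'a) \<noteq> 0"
  obtains \<phi> :: "'a \<Rightarrow> complex" and w where "continuous_on UNIV \<phi>" "\<And>x y. \<phi> (x + y) = \<phi> x * \<phi> y"
    "\<And>x. norm (\<phi> x) = 1" "\<phi> w \<noteq> 1"
proof -
  obtain f x where f: "continuous_on UNIV f" "adj f = f" "f x \<noteq> 0" "\<forall>x. conv (\<lambda>_. 1) f x = 0"
    by (rule nonconstant_hermitian_function[OF assms])
  obtain P0 where "idem P0" by (rule idem_from_hermitian[OF f(1-3) f(4)[rule_format]]) (rule that)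
  \<comment> \<open>Well-ordering is applied to the floor of a real quantity; splitting off an
    idempotent lowers that quantity by at least 1, so the floor detects it.\<close>
  from ex_has_least_nat[of idem P0 "\<lambda>P. nat \<lfloor>sqnorm P\<rfloor>", OF this] obtain P
    where P: "idem P" and "\<forall>Q. idem Q \<longrightarrow> nat \<lfloor>sqnorm P\<rfloor> \<le> nat \<lfloor>sqnorm Q\<rfloor>" by (elim exE conjE)
  then have min: "\<And>Q. idem Q \<Longrightarrow> nat \<lfloor>sqnorm P\<rfloor> \<le> nat \<lfloor>sqnorm Q\<rfloor>" by simp
  have Pc: "continuous_on UNIV P" and Pa: "adj P = P" and PP: "conv P P = P"
    and P1: "\<And>x. conv (\<lambda>_. 1) P x = 0" using P by (auto simp: idem_def)
  have P0: "P 0 = of_real (sqnorm P)" and Ple: "\<And>x. norm (P x) \<le> sqnorm P" and Pge: "sqnorm P \<ge> 1"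
    using idem_sqnorm[OF P] by auto
  have P0nz: "P 0 \<noteq> 0" using P0 Pge by auto
  \<comment> \<open>Convolution with \<open>P\<close> fixes its translates, but these need not be
    hermitian; each is recovered from two hermitian combinations, with \<open>d = 1\<close> and
    \<open>d = \<i>\<close>.\<close>
  have span: "\<exists>c. \<forall>x. P (a + x) = c * P x" for a
  proof -
    let ?q = "\<lambda>x. P (a + x)"
    have qc: "continuous_on UNIV ?q" by (rule cont_shift(2)[OF Pc])
    have Pq: "conv P ?q = ?q" by (simp add: fun_eq_iff conv_shift_right PP)
    have ac: "continuous_on UNIV (adj ?q)" 
      unfolding adj_def by (intro continuous_on_cnj cont_shift(3)[OF qc])
    have Paq: "conv P (adj ?q) = adj ?q"
      using adj_conv[OF Pc qc] by (simp add: Pq Pa)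
    have lin: "\<exists>r. \<forall>x. d * ?q x + cnj d * adj ?q x = r * P x" for d
    proof -
      let ?f = "\<lambda>x. d * ?q x + cnj d * adj ?q x"
      have f1: "continuous_on UNIV ?f" by (intro continuous_intros qc ac)
      have f2: "adj ?f = ?f" by (auto simp: adj_def fun_eq_iff)
      have f3: "conv P ?f = ?f"
      proof
        fix x
        have "conv P ?f x = conv P (\<lambda>x. d * ?q x) x + conv P (\<lambda>x. cnj d * adj ?q x) x"
          by (rule conv_add_right) (intro continuous_intros qc ac Pc)+
        then show "conv P ?f x = ?f x" by (simp only: conv_scale_right Pq Paq)
      qed
      obtain r where r: "?f = (\<lambda>x. r * P x)" by (rule minimal_idem_hermitian[OF P min f1 f2 f3])
      show ?thesis by (intro exI[of _ r] allI) (rule fun_cong[OF r])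
    qed
    obtain r s where r: "\<forall>x. ?q x + adj ?q x = r * P x" and s: "\<forall>x. \<i> * ?q x - \<i> * adj ?q x = s * P x"
      using lin[of 1] lin[of \<i>] by auto
    have "?q x = ((r - \<i> * s) / 2) * P x" for x
    proof -
      have "2 * ?q x = (?q x + adj ?q x) - \<i> * (\<i> * ?q x - \<i> * adj ?q x)"
        by (simp add: algebra_simps)
      also have "\<dots> = r * P x - \<i> * (s * P x)" using r s by simp
      finally show ?thesis by (simp add: algebra_simps)
    qed
    then show ?thesis by (intro exI allI)
  qed
  define \<phi> where "\<phi> = (\<lambda>a. P a / P 0)"
  have sh: "P (a + x) = \<phi> a * P x" for a x
  proof -
    obtain c where "\<forall>x. P (a + x) = c * P x" using span[of a] ..
    then have c: "P (a + x) = c * P x" for x ..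
    from c[of 0] have "c = \<phi> a" using P0nz by (simp add: \<phi>_def)
    then show ?thesis using c by simp
  qed
  have hom: "\<phi> (x + y) = \<phi> x * \<phi> y" for x y
    by (simp add: sh[of x y] \<phi>_def)
  have le: "norm (\<phi> x) \<le> 1" for x
    using Ple[of x] Pge by (simp add: \<phi>_def P0 norm_divide)
  \<comment> \<open>\<open>\<phi> x\<close> and \<open>\<phi> (- x)\<close> are mutually inverse and
    both of modulus at most 1.\<close>
  have one: "norm (\<phi> x) = 1" for x
  proof -
    have "\<phi> x * \<phi> (- x) = 1" using hom[of x "- x"] P0nz by (simp add: \<phi>_def)
    then have "norm (\<phi> x) * norm (\<phi> (- x)) = 1" by (metis norm_mult norm_one)
    moreover have "norm (\<phi> x) * norm (\<phi> (- x)) \<le> norm (\<phi> x) * 1" by (intro mult_left_mono le) auto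
    ultimately show ?thesis using le[of x] by linarith
  qed
  have "\<exists>w. \<phi> w \<noteq> 1"
  proof (rule ccontr)
    assume "\<nexists>w. \<phi> w \<noteq> 1"
    then have "P x = P 0" for x using sh[of x 0] by simp
    then have "conv (\<lambda>_. 1) P 0 = (LINT y|\<mu>. P 0)" unfolding conv_def
      by (intro Bochner_Integration.integral_cong) simp_all
    then have "conv (\<lambda>_. 1) P 0 = P 0" by (simp add: prob_space)
    then show False using P1[of 0] P0nz by simp
  qed
  then obtain w where "\<phi> w \<noteq> 1" ..
  moreover have "continuous_on UNIV \<phi>" unfolding \<phi>_def using P0nz by (intro continuous_intros Pc) auto
  ultimately show thesis using hom one by (intro that[of \<phi> w])
qed

end

section \<open>Densities of sum-free sets\<close>

lemma sum_free_subset: "sum_free k l B \<Longrightarrow> A \<subseteq> B \<Longrightarrow> sum_free k l A"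
  unfolding sum_free_def sumset_pow_def by blast

lemma sum_free_empty: "0 < k \<Longrightarrow> sum_free k l {}"
  unfolding sum_free_def sumset_pow_def by auto

lemma additive_sum:
  fixes \<pi> :: "'a::ab_group_add \<Rightarrow> 'b::ab_group_add"
  assumes "\<And>x y. \<pi> (x + y) = \<pi> x + \<pi> y"
  shows "\<pi> (\<Sum>i<n. a i) = (\<Sum>i<(n::nat). \<pi> (a i))"
proof -
  have "\<pi> 0 = 0" using assms[of 0 0] by simp
  then show ?thesis by (induction n) (simp_all add: assms)
qed

lemma sum_free_vimage:
  fixes \<pi> :: "'a::ab_group_add \<Rightarrow> 'b::ab_group_add"
  assumes "\<And>x y. \<pi> (x + y) = \<pi> x + \<pi> y" "sum_free k l A"
  shows "sum_free k l (\<pi> -` A)"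
proof -
  have "\<pi> x \<in> sumset_pow n A" if "x \<in> sumset_pow n (\<pi> -` A)" for n x
    using that unfolding sumset_pow_def by (auto simp: additive_sum[OF assms(1)])
  then show ?thesis using assms(2) unfolding sum_free_def by blast
qed

context compact_haar
begin

lemma measure_le_lambda_kl:
  assumes "A \<in> sets borel" "sum_free k l A" shows "measure \<mu> A \<le> lambda_kl k l \<mu>"
  unfolding lambda_kl_def
proof (rule cSup_upper)
  show "bdd_above {measure \<mu> A |A. A \<in> sets \<mu> \<and> sum_free k l A}" by (intro bdd_aboveI[of _ 1]) auto
qed (use assms in auto)

lemma lambda_kl_nonneg: "0 < k \<Longrightarrow> 0 \<le> lambda_kl k l \<mu>"
  using measure_le_lambda_kl[of "{}" k l] by (simp add: sum_free_empty)

text \<open>Inner regularity reduces upper bounds to compact sets, whose sumsets are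
  compact.\<close>

lemma lambda_kl_le:
  assumes k: "0 < k" and le: "\<And>K. compact K \<Longrightarrow> sum_free k l K \<Longrightarrow> measure \<mu> K \<le> c"
  shows "lambda_kl k l \<mu> \<le> c"
  unfolding lambda_kl_def
proof (rule cSup_least)
  show "{measure \<mu> A |A. A \<in> sets \<mu> \<and> sum_free k l A} \<noteq> {}"
    using sum_free_empty[OF k, of l] by blast
  fix x assume "x \<in> {measure \<mu> A |A. A \<in> sets \<mu> \<and> sum_free k l A}"
  then obtain A where A: "x = measure \<mu> A" "A \<in> sets borel" "sum_free k l A" by auto
  show "x \<le> c"
  proof (rule field_le_epsilon)
    fix e :: real assume "e > 0"
    with A(2) obtain K where "compact K" "K \<subseteq> A" "measure \<mu> A - e < measure \<mu> K"
      by (rule inner_regular)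
    then show "x \<le> c + e" using le[of K] sum_free_subset[OF A(3)] A(1) by fastforce
  qed
qed

lemma lambda_kl_hom_le:
  fixes \<nu> :: "'b::{topological_ab_group_add, t2_space} measure" and \<pi> :: "'a \<Rightarrow> 'b"
  assumes k: "0 < k" and \<nu>: "haar_prob \<nu>"
    and \<pi>: "continuous_on UNIV \<pi>" "\<And>x y. \<pi> (x + y) = \<pi> x + \<pi> y" "surj \<pi>"
  shows "lambda_kl k l \<nu> \<le> lambda_kl k l \<mu>"
proof -
  have "compact (UNIV :: 'b set)" using compact_continuous_image[OF \<pi>(1) compact_UNIV] \<pi>(3) by simp
  then interpret N: compact_haar \<nu> using \<nu> by unfold_locales
  show ?thesis
  proof (rule N.lambda_kl_le[OF k])
    fix K :: "'b set" assume K: "compact K" "sum_free k l K"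
    have Kb: "K \<in> sets borel" using K(1) by (rule borel_compact)
    have "measure \<nu> K = measure \<mu> (\<pi> -` K)"
      by (rule continuous_hom_measure_preserving[OF compact_UNIV haar \<nu> \<pi> Kb, symmetric])
    also have "\<dots> \<le> lambda_kl k l \<mu>"
      using measurable_sets[OF borel_measurable_continuous_onI[OF \<pi>(1)] Kb] sum_free_vimage[OF \<pi>(2) K(2)]
      by (intro measure_le_lambda_kl) auto
    finally show "measure \<nu> K \<le> lambda_kl k l \<mu>" .
  qed
qed

lemma lambda_kl_connected_le:
  assumes k: "0 < k" and conn: "connected (UNIV :: 'a set)"
  shows "lambda_kl k l \<mu> \<le> 1 / real (k + l)"
proof (rule lambda_kl_le[OF k], rule ccontr)
  fix K :: "'a set" assume K: "compact K" "sum_free k l K" and n: "\<not> measure \<mu> K \<le> 1 / real (k + l)"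
  then have big: "1 < real (k + l) * measure \<mu> K" using k by (simp add: field_simps)
  then have "K \<noteq> {}" by auto
  then obtain x where "x \<in> K" by auto
  then have s: "(\<Sum>i<n. x) \<in> sumset_pow n K" for n unfolding sumset_pow_def by blast
  show False using sum_free_modulo_connected[OF K big conn _ s s] by simp
qed

end

section \<open>Arcs pulled back along a character\<close>

lemma character_sum:
  fixes \<phi> :: "'a::ab_group_add \<Rightarrow> complex"
  assumes hom: "\<And>x y. \<phi> (x + y) = \<phi> x * \<phi> y" and "\<phi> 0 = 1"
    and "\<And>i. i < n \<Longrightarrow> \<phi> (a i) = cis (t i)"
  shows "\<phi> (\<Sum>i<(n::nat). a i) = cis (\<Sum>i<n. t i)"
  using assms(3) by (induction n) (simp_all add: hom assms(2) cis_mult)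

text \<open>The real part takes the value 1 and some \<open>c < 1\<close>, so by connectedness it
  takes \<open>cos t\<close> for a small fraction \<open>t = \<theta> / (n + 1)\<close>; adding up
  \<open>n + 1\<close> copies of the point recovers \<open>\<theta>\<close>.\<close>

lemma character_surj_circle:
  fixes \<phi> :: "'a::topological_ab_group_add \<Rightarrow> complex"
  assumes conn: "connected (UNIV :: 'a set)" and cont: "continuous_on UNIV \<phi>"
    and hom: "\<And>x y. \<phi> (x + y) = \<phi> x * \<phi> y" and norm: "\<And>x. norm (\<phi> x) = 1" and nt: "\<phi> w \<noteq> 1"
  obtains x where "\<phi> x = cis \<theta>"
proof -
  have "\<phi> 0 * \<phi> 0 = \<phi> 0" using hom[of 0 0] by simp
  then have one: "\<phi> 0 = 1" using norm[of 0] by auto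
  define c where "c = Re (\<phi> w)"
  have sq: "(Re (\<phi> x))\<^sup>2 + (Im (\<phi> x))\<^sup>2 = 1" for x using norm[of x] cmod_power2[of "\<phi> x"] by simp
  have "c < 1"
  proof (rule ccontr)
    assume "\<not> c < 1"
    moreover have "c \<le> 1" unfolding c_def using complex_Re_le_cmod[of "\<phi> w"] norm[of w] by simp
    ultimately have "Re (\<phi> w) = 1" by (simp add: c_def)
    then show False using sq[of w] nt by (simp add: complex_eq_iff)
  qed
  have "(\<lambda>n. cos (\<theta> / real (Suc n))) \<longlonglongrightarrow> cos 0"
    by (intro tendsto_cos) (rule LIMSEQ_Suc[OF lim_const_over_n])
  then have "\<forall>\<^sub>F n in sequentially. c < cos (\<theta> / real (Suc n))"
    using \<open>c < 1\<close> by (intro order_tendstoD(1)) auto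
  then obtain n where n: "c < cos (\<theta> / real (Suc n))" by (auto simp: eventually_sequentially)
  define t where "t = \<theta> / real (Suc n)"
  have "connected ((\<lambda>x. Re (\<phi> x)) ` UNIV)"
    by (intro connected_continuous_image continuous_intros cont conn)
  moreover have "c \<in> (\<lambda>x. Re (\<phi> x)) ` UNIV" "1 \<in> (\<lambda>x. Re (\<phi> x)) ` UNIV"
    using one by (auto simp: c_def image_iff intro: exI[of _ 0])
  ultimately have "cos t \<in> (\<lambda>x. Re (\<phi> x)) ` UNIV"
    using connectedD_interval[of "(\<lambda>x. Re (\<phi> x)) ` UNIV" c 1 "cos t"] n by (simp add: t_def less_imp_le)
  then obtain x where x: "Re (\<phi> x) = cos t" by auto
  have "(Im (\<phi> x))\<^sup>2 = (sin t)\<^sup>2" using sq[of x] sin_squared_eq[of t] x by simp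
  then have "\<phi> x = cis t \<or> \<phi> x = cis (- t)" using x by (auto simp: power2_eq_iff complex_eq_iff)
  \<comment> \<open>The real part leaves the sign of the angle open; negation corrects it.\<close>
  moreover have "\<phi> (- x) = cis t" if "\<phi> x = cis (- t)"
  proof -
    have "\<phi> x * \<phi> (- x) = 1" using hom[of x "- x"] one by simp
    then have "cis t * (\<phi> x * \<phi> (- x)) = cis t" by simp
    then show ?thesis unfolding that by (simp add: mult.assoc[symmetric] cis_mult)
  qed
  ultimately obtain y where "\<phi> y = cis t" by blast
  then have "\<phi> (\<Sum>i<Suc n. y) = cis (\<Sum>i<Suc n. t)" by (intro character_sum hom one)
  also have "(\<Sum>i<Suc n. t) = \<theta>" by (simp add: t_def)
  finally show thesis by (rule that)
qed

text \<open>Arcs \<open>[\<alpha>, \<alpha> + 1/(k+l))\<close> with \<open>l \<alpha> = k \<alpha> + k/(k+l)\<close>: the \<open>k\<close>-fold and \<open>l\<close>-fold sums are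
  then adjacent arcs of lengths \<open>k/(k+l)\<close> and \<open>l/(k+l)\<close>.\<close>

lemma sum_free_arc:
  fixes \<phi> :: "'a::ab_group_add \<Rightarrow> complex"
  assumes kl: "1 \<le> k" "k < l" and hom: "\<And>x y. \<phi> (x + y) = \<phi> x * \<phi> y" and one: "\<phi> 0 = 1"
    and \<alpha>: "\<alpha> = real k / (real (k + l) * real (l - k))"
  shows "sum_free k l {x. \<exists>t\<in>{\<alpha>..<\<alpha> + 1 / real (k + l)}. \<phi> x = cis (2 * pi * t)}"
    (is "sum_free k l ?A")
proof -
  have rep: "\<exists>t. real n * \<alpha> \<le> t \<and> t < real n * (\<alpha> + 1 / real (k + l)) \<and> \<phi> x = cis (2 * pi * t)"
    if x: "x \<in> sumset_pow n ?A" and n: "n > 0" for x n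
  proof -
    obtain a where a: "x = (\<Sum>i<n. a i)" "\<forall>i<n. a i \<in> ?A" using x unfolding sumset_pow_def by auto
    then have "\<forall>i\<in>{..<n}. \<exists>t. \<alpha> \<le> t \<and> t < \<alpha> + 1 / real (k + l) \<and> \<phi> (a i) = cis (2 * pi * t)"
      by (simp add: Bex_def conj_assoc)
    from bchoice[OF this] obtain t where
      t: "\<forall>i\<in>{..<n}. \<alpha> \<le> t i \<and> t i < \<alpha> + 1 / real (k + l) \<and> \<phi> (a i) = cis (2 * pi * t i)" ..
    have "\<phi> x = cis (\<Sum>i<n. 2 * pi * t i)" unfolding a(1) using t by (intro character_sum hom one) auto
    moreover have "real n * \<alpha> \<le> (\<Sum>i<n. t i)" using sum_mono[of "{..<n}" "\<lambda>_. \<alpha>" t] t by simp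
    moreover have "(\<Sum>i<n. t i) < (\<Sum>i<n. \<alpha> + 1 / real (k + l))"
      using t n by (intro sum_strict_mono) auto
    ultimately show ?thesis by (intro exI[of _ "\<Sum>i<n. t i"]) (auto simp: sum_distrib_left)
  qed
  show ?thesis
    unfolding sum_free_def
  proof (rule ccontr)
    assume "sumset_pow k ?A \<inter> sumset_pow l ?A \<noteq> {}"
    then obtain x where x: "x \<in> sumset_pow k ?A" "x \<in> sumset_pow l ?A" by blast
    obtain s where s: "real k * \<alpha> \<le> s" "s < real k * (\<alpha> + 1 / real (k + l))" "\<phi> x = cis (2 * pi * s)"
      using rep[OF x(1)] kl by auto
    obtain t where t: "real l * \<alpha> \<le> t" "t < real l * (\<alpha> + 1 / real (k + l))" "\<phi> x = cis (2 * pi * t)"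
      using rep[OF x(2)] kl by auto
    have "real (l - k) * \<alpha> = real k / real (k + l)" unfolding \<alpha> using kl by simp
    then have la: "real l * \<alpha> = real k * \<alpha> + real k / real (k + l)" using kl by (simp add: of_nat_diff algebra_simps)
    have "real k / real (k + l) + real l / real (k + l) = 1" using kl by (simp add: add_divide_distrib[symmetric])
    \<comment> \<open>\<open>s\<close> and \<open>t\<close> lie in half-open intervals that abut at
      \<open>l * \<alpha>\<close> and have total length 1, so the angles cannot differ by whole
      turns.\<close>
    then have b: "0 < t - s" "t - s < 1" using s t la by (simp_all add: distrib_left)
    have "cis (2 * pi * (t - s)) = cis (2 * pi * t) / cis (2 * pi * s)"
      by (simp add: cis_divide right_diff_distrib)
    also have "\<dots> = 1" using s(3) t(3) by simp
    finally have "cos (2 * pi * (t - s)) = 1" by (simp add: complex_eq_iff)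
    then obtain m :: int where "2 * pi * (t - s) = real_of_int m * 2 * pi" by (auto simp: cos_one_2pi_int)
    then have "t - s = real_of_int m" by simp
    then show False using b by simp
  qed
qed

context compact_haar
begin

text \<open>The preimage of the arc is measured from below by covering: with \<open>u\<close> sent
  to the rotation by \<open>1 / N\<close> of a turn, its translates by \<open>N\<close> multiples of
  \<open>u\<close> exhaust the group.\<close>

lemma lambda_kl_connected_ge:
  assumes kl: "1 \<le> k" "k < l" and conn: "connected (UNIV :: 'a set)" and z: "(z::'a) \<noteq> 0"
  shows "1 / real (k + l) \<le> lambda_kl k l \<mu>"
proof -
  obtain \<phi> :: "'a \<Rightarrow> complex" and w where cont: "continuous_on UNIV \<phi>"
    and hom: "\<And>x y. \<phi> (x + y) = \<phi> x * \<phi> y" and norm: "\<And>x. norm (\<phi> x) = 1" and nt: "\<phi> w \<noteq> 1"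
    using nontrivial_character_exists[OF z] by blast
  have "\<phi> 0 * \<phi> 0 = \<phi> 0" using hom[of 0 0] by simp
  then have one: "\<phi> 0 = 1" using norm[of 0] by auto
  define N where "N = k + l"
  have N: "N > 0" using kl by (simp add: N_def)
  define \<alpha> where "\<alpha> = real k / (real (k + l) * real (l - k))"
  let ?J = "{\<alpha>..<\<alpha> + 1 / real N}"
  define A where "A = {x. \<exists>t\<in>?J. \<phi> x = cis (2 * pi * t)}"
  have sf: "sum_free k l A"
    unfolding A_def N_def by (rule sum_free_arc[OF kl hom one \<alpha>_def])
  have Ab: "A \<in> sets borel"
  proof -
    \<comment> \<open>Closed arcs are compact, as images of compact intervals, so this countable
      union shows that \<open>A\<close> is Borel.\<close>
    have "?J = (\<Union>n. {\<alpha>..\<alpha> + 1 / real N - 1 / real (Suc n)})"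
    proof (intro set_eqI iffI)
      fix t assume t: "t \<in> ?J"
      then obtain n where "inverse (real (Suc n)) < \<alpha> + 1 / real N - t"
        using reals_Archimedean[of "\<alpha> + 1 / real N - t"] by auto
      then show "t \<in> (\<Union>n. {\<alpha>..\<alpha> + 1 / real N - 1 / real (Suc n)})"
        using t by (intro UN_I[of n]) (auto simp: inverse_eq_divide)
    next
      fix t assume "t \<in> (\<Union>n. {\<alpha>..\<alpha> + 1 / real N - 1 / real (Suc n)})"
      then obtain n where "\<alpha> \<le> t" "t \<le> \<alpha> + 1 / real N - 1 / real (Suc n)" by auto
      moreover have "1 / real (Suc n) > 0" by simp
      ultimately have "\<alpha> \<le> t" "t < \<alpha> + 1 / real N" by linarith+
      then show "t \<in> ?J" by simp
    qed
    then have "A = (\<Union>n. \<phi> -` ((\<lambda>t. cis (2 * pi * t)) ` {\<alpha>..\<alpha> + 1 / real N - 1 / real (Suc n)}))"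
      unfolding A_def by auto
    moreover have "\<phi> -` ((\<lambda>t. cis (2 * pi * t)) ` {a..b}) \<in> sets borel" for a b
    proof -
      have "compact ((\<lambda>t. cis (2 * pi * t)) ` {a..b})"
        by (intro compact_continuous_image continuous_intros) auto
      then show ?thesis
        using measurable_sets[OF continuous_measurable[OF cont] borel_compact] by simp
    qed
    ultimately show ?thesis by (auto intro!: sets.countable_UN)
  qed
  obtain u where u: "\<phi> u = cis (2 * pi / real N)"
    using character_surj_circle[OF conn cont hom norm nt] by blast
  have cover: "\<exists>j<N. x \<in> (\<lambda>y. (\<Sum>i<j. u) + y) ` A" for x
  proof -
    define t where "t = Arg (\<phi> x) / (2 * pi)"
    have x: "\<phi> x = cis (2 * pi * t)" using cis_Arg[of "\<phi> x"] norm[of x] by (cases "\<phi> x = 0") (auto simp: t_def sgn_eq)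
    \<comment> \<open>\<open>m\<close> steps of length \<open>1 / N\<close> bring \<open>t\<close>
      back into \<open>?J\<close>; reducing \<open>m\<close> modulo \<open>N\<close> changes the
      angle by full turns only.\<close>
    define m where "m = \<lfloor>real N * (t - \<alpha>)\<rfloor>"
    define j where "j = nat (m mod int N)"
    have j: "j < N" "int j = m mod int N" using N by (auto simp: j_def nat_less_iff)
    define d where "d = m div int N"
    have d: "m = int j + d * int N" unfolding j(2) d_def by simp
    let ?t = "t - of_int m / real N"
    have "real N * (?t - \<alpha>) = real N * (t - \<alpha>) - of_int m" using N by (simp add: algebra_simps)
    moreover have "of_int m \<le> real N * (t - \<alpha>)" "real N * (t - \<alpha>) < of_int m + 1"
      unfolding m_def by (rule of_int_floor_le real_of_int_floor_add_one_gt)+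
    ultimately have "0 \<le> real N * (?t - \<alpha>)" "real N * (?t - \<alpha>) < 1" by linarith+
    then have "0 \<le> ?t - \<alpha>" "?t - \<alpha> < 1 / real N"
      using N by (simp_all only: zero_le_mult_iff pos_less_divide_eq of_nat_0_less_iff mult.commute) auto
    then have tJ: "?t \<in> ?J" by simp
    have "\<phi> (\<Sum>i<j. u) = cis (\<Sum>i<j. 2 * pi / real N)" using u by (intro character_sum hom one)
    then have c: "\<phi> (\<Sum>i<j. u) = cis (2 * pi * (real j / real N))"
      by (simp add: mult_ac)
    have "\<phi> (\<Sum>i<j. u) * \<phi> (- (\<Sum>i<j. u) + x) = \<phi> x" unfolding hom[symmetric] by simp
    then have "\<phi> (- (\<Sum>i<j. u) + x) = cis (2 * pi * t) / cis (2 * pi * (real j / real N))"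
      unfolding x c by (subst nonzero_eq_divide_eq) (simp_all add: mult.commute)
    also have "\<dots> = cis (2 * pi * t - 2 * pi * (real j / real N))" by (rule cis_divide)
    also have "2 * pi * t - 2 * pi * (real j / real N) = 2 * pi * ?t + 2 * pi * of_int d"
      using N by (simp add: d field_simps)
    also have "cis \<dots> = cis (2 * pi * ?t)"
      unfolding cis_mult[symmetric] by (simp add: cis_multiple_2pi)
    finally have "- (\<Sum>i<j. u) + x \<in> A" unfolding A_def using tJ by blast
    then show ?thesis using j(1) unfolding plus_image_eq_vimage by auto
  qed
  have "(\<Union>j<N. (\<lambda>y. (\<Sum>i<j. u) + y) ` A) = UNIV" using cover by blast
  then have "1 = measure \<mu> (\<Union>j<N. (\<lambda>y. (\<Sum>i<j. u) + y) ` A)" by simp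
  also have "\<dots> \<le> (\<Sum>j<N. measure \<mu> ((\<lambda>y. (\<Sum>i<j. u) + y) ` A))"
    using borel_plus_image[OF Ab] by (intro finite_measure_subadditive_finite) auto
  also have "\<dots> = real N * measure \<mu> A" using Ab by (simp add: measure_plus_image)
  finally have "1 / real N \<le> measure \<mu> A" using N by (simp add: field_simps)
  also have "\<dots> \<le> lambda_kl k l \<mu>" by (rule measure_le_lambda_kl[OF Ab sf])
  finally show ?thesis by (simp add: N_def)
qed

end

theorem mainTheorem1:
  fixes k l :: nat
    and \<mu>G :: "('i::{topological_ab_group_add, t2_space} \<times> 'm::{topological_ab_group_add, t2_space}) measure"
    and \<mu>I :: "'i measure"
    and \<mu>M :: "'m measure"
  assumes "1 \<le> k" and "k < l"
    and "compact (UNIV :: ('i \<times> 'm) set)"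
    and "connected_component_set (UNIV :: ('i \<times> 'm) set) 0 = UNIV \<times> {0}"
    and "haar_prob \<mu>G" and "haar_prob \<mu>I" and "haar_prob \<mu>M"
  shows "lambda_kl k l \<mu>G = max (lambda_kl k l \<mu>M) (lambda_kl k l \<mu>I) \<and>
    ((\<exists>x::'i. x \<noteq> 0) \<longrightarrow>
      lambda_kl k l \<mu>I = 1 / real (k + l) \<and>
      lambda_kl k l \<mu>G = max (lambda_kl k l \<mu>M) (1 / real (k + l)))"
proof -
  have k: "0 < k" using assms(1) by simp
  have cf: "continuous_on UNIV (fst :: 'i \<times> 'm \<Rightarrow> 'i)" and cs: "continuous_on UNIV (snd :: 'i \<times> 'm \<Rightarrow> 'm)"
    by (intro continuous_intros)+
  have cI: "compact (UNIV :: 'i set)" and cM: "compact (UNIV :: 'm set)"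
    using compact_continuous_image[OF cf assms(3)] compact_continuous_image[OF cs assms(3)] by simp_all
  interpret G: compact_haar \<mu>G using assms by unfold_locales
  interpret I: compact_haar \<mu>I using assms cI by unfold_locales
  interpret M: compact_haar \<mu>M using assms cM by unfold_locales
  have conG: "connected (UNIV \<times> {0} :: ('i \<times> 'm) set)"
    using connected_connected_component[of "UNIV :: ('i \<times> 'm) set" 0] assms(4) by simp
  have "connected (fst ` (UNIV \<times> {0} :: ('i \<times> 'm) set))"
    by (intro connected_continuous_image conG continuous_intros)
  then have conI: "connected (UNIV :: 'i set)" by (simp add: fst_image_times)
  have geM: "lambda_kl k l \<mu>M \<le> lambda_kl k l \<mu>G"
    by (rule G.lambda_kl_hom_le[OF k assms(7) cs]) auto
  have geI: "lambda_kl k l \<mu>I \<le> lambda_kl k l \<mu>G"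
    by (rule G.lambda_kl_hom_le[OF k assms(6) cf]) auto
  \<comment> \<open>\<open>K\<close> is enlarged to the full preimage of its projection, which has
    the measure of the projection; the point is that the projection stays sum-free.\<close>
  have proj: "measure \<mu>G K \<le> lambda_kl k l \<mu>M"
    if K: "compact K" "sum_free k l K" and big: "(\<forall>x::'i. x = 0) \<or> 1 < real (k + l) * measure \<mu>G K" for K
  proof -
    have "sum_free k l (snd ` K)"
      unfolding sum_free_def
    proof (rule ccontr)
      assume "sumset_pow k (snd ` K) \<inter> sumset_pow l (snd ` K) \<noteq> {}"
      then obtain y where y: "y \<in> sumset_pow k (snd ` K)" "y \<in> sumset_pow l (snd ` K)" by blast
      have lift: "\<exists>x\<in>sumset_pow n K. snd x = y" if yn: "y \<in> sumset_pow n (snd ` K)" for n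
      proof -
        obtain b where b: "y = (\<Sum>i<n. b i)" "\<forall>i<n. b i \<in> snd ` K" using yn unfolding sumset_pow_def by auto
        then have "\<forall>i\<in>{..<n}. \<exists>x. x \<in> K \<and> snd x = b i"
          by (metis imageE lessThan_iff)
        from bchoice[OF this] obtain a where a: "\<forall>i\<in>{..<n}. a i \<in> K \<and> snd (a i) = b i" ..
        have "snd (\<Sum>i<n. a i) = y" unfolding b(1) using a by (simp add: snd_sum)
        then show ?thesis using a unfolding sumset_pow_def by (intro bexI[of _ "\<Sum>i<n. a i"]) auto
      qed
      obtain p q where pq: "p \<in> sumset_pow k K" "q \<in> sumset_pow l K" "snd p = y" "snd q = y"
        using lift[OF y(1)] lift[OF y(2)] by blast
      \<comment> \<open>Two lifts of the same \<open>y\<close> differ by an element of the identity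
        component.\<close>
      have d: "q - p \<in> UNIV \<times> {0}" using pq by (simp add: mem_Times_iff)
      from big show False
      proof
        assume "\<forall>x::'i. x = 0"
        then have "fst p = fst q" by metis
        then have "p = q" using pq by (simp add: prod_eq_iff)
        then show False using K(2) pq unfolding sum_free_def by auto
      next
        assume "1 < real (k + l) * measure \<mu>G K"
        from G.sum_free_modulo_connected[OF K this conG _ pq(1,2)] d show False by (simp add: zero_prod_def)
      qed
    qed
    moreover have "compact (snd ` K)"
      using K(1) by (intro compact_continuous_image continuous_intros)
    then have b: "snd ` K \<in> sets borel" by (rule borel_compact)
    ultimately have "measure \<mu>M (snd ` K) \<le> lambda_kl k l \<mu>M" by (intro M.measure_le_lambda_kl)
    moreover have "measure \<mu>G (snd -` (snd ` K)) = measure \<mu>M (snd ` K)"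
      by (rule continuous_hom_measure_preserving[OF assms(3,5,7) cs _ _ b]) auto
    moreover have "measure \<mu>G K \<le> measure \<mu>G (snd -` (snd ` K))"
      using measurable_sets[OF borel_measurable_continuous_onI[OF cs] b]
      by (intro G.finite_measure_mono) auto
    ultimately show ?thesis by linarith
  qed
  show ?thesis
  proof (cases "\<exists>x::'i. x \<noteq> 0")
    case True
    then obtain z :: 'i where z: "z \<noteq> 0" by blast
    have I: "lambda_kl k l \<mu>I = 1 / real (k + l)"
      using I.lambda_kl_connected_le[OF k conI] I.lambda_kl_connected_ge[OF assms(1,2) conI z] by (rule antisym)
    have "lambda_kl k l \<mu>G \<le> max (lambda_kl k l \<mu>M) (1 / real (k + l))"
    proof (rule G.lambda_kl_le[OF k])
      fix K :: "('i \<times> 'm) set" assume K: "compact K" "sum_free k l K"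
      show "measure \<mu>G K \<le> max (lambda_kl k l \<mu>M) (1 / real (k + l))"
      proof (cases "1 < real (k + l) * measure \<mu>G K")
        case True
        then show ?thesis using proj[OF K] by simp
      next
        case False
        then have "measure \<mu>G K \<le> 1 / real (k + l)" using k by (simp add: field_simps)
        then show ?thesis by simp
      qed
    qed
    then have "lambda_kl k l \<mu>G = max (lambda_kl k l \<mu>M) (1 / real (k + l))"
      using I geM geI by (intro antisym max.boundedI) simp_all
    then show ?thesis using I by simp
  next
    case False
    then have triv: "\<forall>x::'i. x = 0" by blast
    \<comment> \<open>In the trivial group a nonempty set contains 0, which is both a
      \<open>k\<close>-fold and an \<open>l\<close>-fold sum, so only the empty set is
      sum-free.\<close>
    have "lambda_kl k l \<mu>I \<le> 0"
    proof (rule I.lambda_kl_le[OF k])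
      fix K :: "'i set" assume K: "sum_free k l K"
      have "K = {}"
      proof (rule ccontr)
        assume "K \<noteq> {}"
        then have "0 \<in> K" using triv by (metis ex_in_conv)
        then have "(\<Sum>i<n. 0) \<in> sumset_pow n K" for n unfolding sumset_pow_def by blast
        then have "0 \<in> sumset_pow n K" for n by simp
        then show False using K unfolding sum_free_def by blast
      qed
      then show "measure \<mu>I K \<le> 0" by simp
    qed
    moreover have "lambda_kl k l \<mu>G \<le> lambda_kl k l \<mu>M"
      by (rule G.lambda_kl_le[OF k]) (use proj triv in blast)
    ultimately show ?thesis using False geM M.lambda_kl_nonneg[OF k, of l] by (simp add: max_def)
  qed
qed

end
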